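(* Let $H$ be a complex Hilbert space and let $T$ be a (possibly unbounded) self-adjoint operator with domain $D(T)$, a dense linear subspace of $H$. Then there exists a spectral family $E(\lambda)$ $(\lambda\in\mathbb{R})$ on $H$ such that for every $x\in D(T)$ $$Tx=\int_{-\infty}^{\infty}\lambda\, dE(\lambda)x .$$ Moreover, if $E(\lambda)x$ is right-continuous in $\lambda$ (for every $x \in H$), the spectral family is unique; that is, any two spectral families on $H$ which represent $T$ in this way for all $x\in D(T)$ and for which $\lambda\mapsto E(\lambda)x$ is right-continuous for every $x\in H$ coincide.
   Context: A spectral family on a complex Hilbert space $H$ is a family of orthogonal projections $E(\lambda)$ $(\lambda\in\mathbb{R})$ on $H$ which is non-decreasing in $\lambda$ and satisfies $\lim_{\lambda\to-\infty}E(\lambda)x=0$ and $\lim_{\lambda\to\infty}E(\lambda)x=x$ (in norm) for every $x\in H$. No right-continuity is required in this definition. For real $a<b$, $\int_a^b \lambda\,dE(\lambda)x$ denotes the Riemann-Stieltjes type integral, i.e. the norm limit in $H$ of the sums $\sum_{k=1}^n s_k(E(s_k)-E(s_{k-1}))x$ over partitions $a=s_0<s_1<\dots<s_n=b$ as the mesh tends to $0$. The integral $\int_{-\infty}^{\infty}\lambda\,dE(\lambda)x$ is the norm limit of $\int_a^b\lambda\,dE(\lambda)x$ as $a\to-\infty$, $b\to\infty$; the displayed equality includes the assertion that this limit exists. *)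

theory Defs
  imports "HOL-Analysis.Analysis"
begin

text \<open>
  A complex Hilbert space, whose underlying real Hilbert space carries the real inner product
  \<open>Re \<langle>x, y\<rangle>\<close>. The inner product is linear in the first argument. Positive definiteness and
  \<open>norm x = sqrt \<langle>x, x\<rangle>\<close> follow from the axioms of \<^class>\<open>real_inner\<close>, since \<open>\<langle>x, x\<rangle>\<close> is real
  by conjugate symmetry.
\<close>

class complex_hilbert_space = real_inner + banach +
  fixes scaleC :: "complex \<Rightarrow> 'a \<Rightarrow> 'a"  (infixr "*\<^sub>C" 75)
    and cinner :: "'a \<Rightarrow> 'a \<Rightarrow> complex"
  assumes scaleC_add_right: "c *\<^sub>C (x + y) = c *\<^sub>C x + c *\<^sub>C y"
    and scaleC_add_left: "(c + d) *\<^sub>C x = c *\<^sub>C x + d *\<^sub>C x"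
    and scaleC_scaleC: "c *\<^sub>C (d *\<^sub>C x) = (c * d) *\<^sub>C x"
    and scaleC_of_real: "complex_of_real r *\<^sub>C x = r *\<^sub>R x"
    and cinner_commute: "cinner x y = cnj (cinner y x)"
    and cinner_add_left: "cinner (x + y) z = cinner x z + cinner y z"
    and cinner_scaleC_left: "cinner (c *\<^sub>C x) y = c * cinner x y"
    and inner_eq_Re_cinner: "inner x y = Re (cinner x y)"

text \<open>
  An operator is a pair of a domain \<open>D\<close> and a function \<open>T\<close>; the values of \<open>T\<close> outside \<open>D\<close>
  are irrelevant.
\<close>

definition csubspace :: "'a::complex_hilbert_space set \<Rightarrow> bool" where
  "csubspace D \<longleftrightarrow>
     0 \<in> D \<and> (\<forall>x\<in>D. \<forall>y\<in>D. x + y \<in> D) \<and> (\<forall>c. \<forall>x\<in>D. c *\<^sub>C x \<in> D)"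

definition clinear_on ::
    "'a::complex_hilbert_space set \<Rightarrow> ('a \<Rightarrow> 'a) \<Rightarrow> bool" where
  "clinear_on D T \<longleftrightarrow>
     (\<forall>x\<in>D. \<forall>y\<in>D. T (x + y) = T x + T y) \<and> (\<forall>c. \<forall>x\<in>D. T (c *\<^sub>C x) = c *\<^sub>C T x)"

definition densely_defined_operator ::
    "'a::complex_hilbert_space set \<Rightarrow> ('a \<Rightarrow> 'a) \<Rightarrow> bool" where
  "densely_defined_operator D T \<longleftrightarrow> csubspace D \<and> closure D = UNIV \<and> clinear_on D T"

definition adjoint_domain ::
    "'a::complex_hilbert_space set \<Rightarrow> ('a \<Rightarrow> 'a) \<Rightarrow> 'a set" where
  "adjoint_domain D T = {y. \<exists>z. \<forall>x\<in>D. cinner (T x) y = cinner x z}"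

text \<open>The vector \<open>z\<close> is unique because \<open>D\<close> is dense.\<close>

definition adjoint_operator ::
    "'a::complex_hilbert_space set \<Rightarrow> ('a \<Rightarrow> 'a) \<Rightarrow> 'a \<Rightarrow> 'a" where
  "adjoint_operator D T y = (THE z. \<forall>x\<in>D. cinner (T x) y = cinner x z)"

definition self_adjoint_operator ::
    "'a::complex_hilbert_space set \<Rightarrow> ('a \<Rightarrow> 'a) \<Rightarrow> bool" where
  "self_adjoint_operator D T \<longleftrightarrow>
     densely_defined_operator D T \<and> adjoint_domain D T = D \<and>
     (\<forall>y\<in>D. adjoint_operator D T y = T y)"

definition orthogonal_projection :: "('a::complex_hilbert_space \<Rightarrow> 'a) \<Rightarrow> bool" where
  "orthogonal_projection P \<longleftrightarrow>
     bounded_linear P \<and> clinear_on UNIV P \<and>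
     (\<forall>x. P (P x) = P x) \<and> (\<forall>x y. cinner (P x) y = cinner x (P y))"

text \<open>The usual order on bounded self-adjoint operators: \<open>B - A\<close> is positive.\<close>

definition operator_le ::
    "('a::complex_hilbert_space \<Rightarrow> 'a) \<Rightarrow> ('a \<Rightarrow> 'a) \<Rightarrow> bool" where
  "operator_le A B \<longleftrightarrow> (\<forall>x. cinner (B x - A x) x \<in> \<real>\<^sub>\<ge>\<^sub>0)"

definition spectral_family :: "(real \<Rightarrow> 'a::complex_hilbert_space \<Rightarrow> 'a) \<Rightarrow> bool" where
  "spectral_family E \<longleftrightarrow>
     (\<forall>\<mu>. orthogonal_projection (E \<mu>)) \<and>
     (\<forall>\<mu> \<nu>. \<mu> \<le> \<nu> \<longrightarrow> operator_le (E \<mu>) (E \<nu>)) \<and>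
     (\<forall>x. ((\<lambda>\<mu>. E \<mu> x) \<longlongrightarrow> 0) at_bot) \<and>
     (\<forall>x. ((\<lambda>\<mu>. E \<mu> x) \<longlongrightarrow> x) at_top)"

definition right_continuous_family ::
    "(real \<Rightarrow> 'a::complex_hilbert_space \<Rightarrow> 'a) \<Rightarrow> bool" where
  "right_continuous_family E \<longleftrightarrow> (\<forall>x \<mu>. ((\<lambda>\<nu>. E \<nu> x) \<longlongrightarrow> E \<mu> x) (at_right \<mu>))"

text \<open>A partition \<open>a = s 0 < s 1 < \<dots> < s n = b\<close>; the values \<open>s k\<close> for \<open>k > n\<close> are irrelevant.\<close>

definition is_partition :: "real \<Rightarrow> real \<Rightarrow> nat \<Rightarrow> (nat \<Rightarrow> real) \<Rightarrow> bool" where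
  "is_partition a b n s \<longleftrightarrow>
     n \<ge> 1 \<and> s 0 = a \<and> s n = b \<and> (\<forall>k\<in>{1..n}. s (k - 1) < s k)"

definition spectral_sum ::
    "(real \<Rightarrow> 'a::complex_hilbert_space \<Rightarrow> 'a) \<Rightarrow> 'a \<Rightarrow> nat \<Rightarrow> (nat \<Rightarrow> real) \<Rightarrow> 'a" where
  "spectral_sum E x n s = (\<Sum>k=1..n. s k *\<^sub>R (E (s k) x - E (s (k - 1)) x))"

definition has_spectral_integral_on ::
    "(real \<Rightarrow> 'a::complex_hilbert_space \<Rightarrow> 'a) \<Rightarrow> 'a \<Rightarrow> real \<Rightarrow> real \<Rightarrow> 'a \<Rightarrow> bool" where
  "has_spectral_integral_on E x a b I \<longleftrightarrow>
     (\<forall>\<epsilon>>0. \<exists>\<delta>>0. \<forall>n s.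
        is_partition a b n s \<and> (\<forall>k\<in>{1..n}. s k - s (k - 1) < \<delta>) \<longrightarrow>
        norm (spectral_sum E x n s - I) < \<epsilon>)"

text \<open>
  \<open>y\<close> is the value of the integral over the whole line: the integral \<open>J a b\<close> exists for all
  \<open>a < b\<close> and converges to \<open>y\<close> as \<open>a\<close> and \<open>b\<close> tend to \<open>-\<infinity>\<close> and \<open>\<infinity>\<close> independently.
\<close>

definition has_spectral_integral ::
    "(real \<Rightarrow> 'a::complex_hilbert_space \<Rightarrow> 'a) \<Rightarrow> 'a \<Rightarrow> 'a \<Rightarrow> bool" where
  "has_spectral_integral E x y \<longleftrightarrow>
     (\<exists>J. (\<forall>a b. a < b \<longrightarrow> has_spectral_integral_on E x a b (J a b)) \<and>
          ((\<lambda>(a, b). J a b) \<longlongrightarrow> y) (at_bot \<times>\<^sub>F at_top))"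

definition represents_operator ::
    "(real \<Rightarrow> 'a::complex_hilbert_space \<Rightarrow> 'a) \<Rightarrow> 'a set \<Rightarrow> ('a \<Rightarrow> 'a) \<Rightarrow> bool" where
  "represents_operator E D T \<longleftrightarrow> (\<forall>x\<in>D. has_spectral_integral E x (T x))"

end

theory Submission
  imports Defs
begin

text \<open>
  The spectral projection \<open>E(\<lambda>)\<close> is constructed from bounded operators only. For \<open>L = T - \<lambda>\<close> the
  operators \<open>B = (1 + L\<^sup>2)\<^sup>-\<^sup>1\<close> and \<open>C = L B\<close> are bounded and self-adjoint, and \<open>C\<close> has the same sign
  as \<open>L\<close>, since \<open>\<langle>L x, x\<rangle> = \<langle>C x, x\<rangle> + \<langle>C L x, L x\<rangle>\<close>. The operator \<open>Z = 1 + C\<close> is positive, and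
  \<open>E(\<lambda>)\<close> is the projection onto the vectors with bounded \<open>Z\<close>-orbit: there \<open>Z \<le> 1\<close>, hence
  \<open>T \<le> \<lambda>\<close>, while \<open>Z \<ge> 1\<close>, hence \<open>T \<ge> \<lambda>\<close>, on the orthogonal complement. These form bounds give
  monotonicity, the limits at infinity and the convergence of the spectral sums. Conversely, any
  spectral family representing \<open>T\<close> commutes with \<open>T\<close> and satisfies the same form bounds, so it
  interlaces with the constructed one, and right-continuity makes it unique.

  Everything except the final translation is real Hilbert space theory, for the real inner product
  \<open>Re \<langle>x, y\<rangle>\<close>; complex linearity amounts to commuting with multiplication by \<open>\<i>\<close>.
\<close>

section \<open>Orthogonal projections in real Hilbert spaces\<close>

lemma cancel_norm_le:
  assumes "a * (norm v)\<^sup>2 \<le> b * norm v" "0 \<le> b"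
  shows "a * norm v \<le> b"
proof (cases "norm v = 0")
  case False
  have "(a * norm v) * norm v \<le> b * norm v"
    using assms(1) by (simp add: power2_eq_square mult.assoc)
  with False show ?thesis
    by (simp only: mult_le_cancel_right) auto
qed (use assms(2) in simp)

lemma norm_le_if_square_le: "(norm x)\<^sup>2 \<le> norm y * norm x \<Longrightarrow> norm x \<le> norm y"
  using cancel_norm_le[of 1 x "norm y"] by simp

lemma parallelogram_law:
  fixes x y :: "'a::real_inner"
  shows "(norm (x + y))\<^sup>2 + (norm (x - y))\<^sup>2 = 2 * (norm x)\<^sup>2 + 2 * (norm y)\<^sup>2"
  by (simp add: power2_norm_eq_inner inner_diff_left inner_diff_right inner_add_left
      inner_add_right inner_commute)

text \<open>A minimising sequence for the distance to \<open>M\<close> is Cauchy by the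
  parallelogram law, because midpoints stay in \<open>M\<close>. Its limit is the nearest point, and
  varying it along \<open>z\<close> gives orthogonality.\<close>

lemma orthogonal_decomposition:
  fixes M :: "'a::{real_inner,banach} set"
  assumes "closed M" "subspace M"
  shows "\<exists>y\<in>M. \<forall>z\<in>M. inner (x - y) z = 0"
proof -
  define d where "d = Inf ((\<lambda>y. (norm (x - y))\<^sup>2) ` M)"
  have bdd: "bdd_below ((\<lambda>y. (norm (x - y))\<^sup>2) ` M)"
    by (rule bdd_belowI[of _ 0]) auto
  have ne: "M \<noteq> {}"
    using assms(2) subspace_0 by blast
  have low: "d \<le> (norm (x - y))\<^sup>2" if "y \<in> M" for y
    unfolding d_def using that bdd by (intro cInf_lower) auto
  have "\<exists>y\<in>M. (norm (x - y))\<^sup>2 < d + 1 / Suc n" for n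
  proof -
    have "Inf ((\<lambda>y. (norm (x - y))\<^sup>2) ` M) < d + 1 / Suc n"
      by (simp add: d_def)
    then show ?thesis
      using ne by (subst (asm) cInf_less_iff) (use bdd in auto)
  qed
  then obtain f where fM: "\<And>n. f n \<in> M" and f: "\<And>n. (norm (x - f n))\<^sup>2 < d + 1 / Suc n"
    by metis
  have close: "(norm (f n - f m))\<^sup>2 \<le> 2 / Suc n + 2 / Suc m" for n m
  proof -
    have "(1/2) *\<^sub>R (f n + f m) \<in> M"
      using fM assms(2) by (simp add: subspace_add subspace_scale)
    then have "d \<le> (norm (x - (1/2) *\<^sub>R (f n + f m)))\<^sup>2"
      by (rule low)
    moreover have "(x - f n) + (x - f m) = 2 *\<^sub>R (x - (1/2) *\<^sub>R (f n + f m))"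
      by (simp add: algebra_simps scaleR_2)
    then have "(norm ((x - f n) + (x - f m)))\<^sup>2 = 4 * (norm (x - (1/2) *\<^sub>R (f n + f m)))\<^sup>2"
      by (simp add: power_mult_distrib)
    moreover have "norm ((x - f n) - (x - f m)) = norm (f n - f m)"
      by (simp add: norm_minus_commute)
    ultimately have "4 * d + (norm (f n - f m))\<^sup>2 \<le> 2 * (norm (x - f n))\<^sup>2 + 2 * (norm (x - f m))\<^sup>2"
      using parallelogram_law[of "x - f n" "x - f m"] by simp
    then show ?thesis
      using f[of n] f[of m] by simp
  qed
  have "Cauchy f"
  proof (rule CauchyI)
    fix e :: real assume "e > 0"
    then have "0 < e\<^sup>2 / 4" by simp
    then obtain N where N: "1 / Suc N < e\<^sup>2 / 4"
      using nat_approx_posE by metis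
    have "norm (f m - f n) < e" if "m \<ge> N" "n \<ge> N" for m n
    proof -
      have "1 / Suc m \<le> 1 / Suc N" "1 / Suc n \<le> 1 / Suc N"
        using that by (auto intro!: divide_left_mono)
      then have "(norm (f m - f n))\<^sup>2 < e\<^sup>2"
        using close[of m n] N by simp
      then show ?thesis
        using \<open>e > 0\<close> power2_less_imp_less by fastforce
    qed
    then show "\<exists>N. \<forall>m\<ge>N. \<forall>n\<ge>N. norm (f m - f n) < e"
      by blast
  qed
  then obtain y where y: "f \<longlonglongrightarrow> y"
    using Cauchy_convergent_iff convergent_def by blast
  have yM: "y \<in> M"
    using assms(1) fM y closed_sequentially by blast
  have "(norm (x - y))\<^sup>2 \<le> d"
  proof (rule LIMSEQ_le)
    show "(\<lambda>n. (norm (x - f n))\<^sup>2) \<longlonglongrightarrow> (norm (x - y))\<^sup>2"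
      by (intro tendsto_intros y)
    show "(\<lambda>n. d + 1 / Suc n) \<longlonglongrightarrow> d"
      using tendsto_add[OF tendsto_const LIMSEQ_Suc[OF lim_1_over_n]] by fastforce
    show "\<exists>N. \<forall>n\<ge>N. (norm (x - f n))\<^sup>2 \<le> d + 1 / Suc n"
      using f less_imp_le by blast
  qed
  have "inner (x - y) z = 0" if z: "z \<in> M" for z
  proof (cases "z = 0")
    case False
    \<comment> \<open>This \<open>t\<close> minimises the squared distance from \<open>x\<close> to
      \<open>y + t *\<^sub>R z\<close>; the decrease it would produce contradicts minimality unless
      the inner product is zero.\<close>
    define t where "t = inner (x - y) z / (norm z)\<^sup>2"
    have "y + t *\<^sub>R z \<in> M"
      using yM z assms(2) by (simp add: subspace_add subspace_scale)
    from low[OF this] have "(norm (x - y))\<^sup>2 \<le> (norm ((x - y) - t *\<^sub>R z))\<^sup>2"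
      using \<open>(norm (x - y))\<^sup>2 \<le> d\<close> by (simp only: diff_diff_eq)
    also have "\<dots> = (norm (x - y))\<^sup>2 - 2 * t * inner (x - y) z + t\<^sup>2 * (norm z)\<^sup>2"
      unfolding power2_norm_eq_inner
      by (simp add: inner_diff_left inner_diff_right inner_commute power2_eq_square algebra_simps)
    also have "\<dots> = (norm (x - y))\<^sup>2 - (inner (x - y) z)\<^sup>2 / (norm z)\<^sup>2"
      using False by (simp add: t_def power2_eq_square divide_simps)
    finally have "(inner (x - y) z)\<^sup>2 / (norm z)\<^sup>2 \<le> 0" by simp
    then show ?thesis
      using False by (simp add: divide_le_0_iff)
  qed simp
  with yM show ?thesis by blast
qed

definition ortho_proj :: "('a::real_inner \<Rightarrow> 'a) \<Rightarrow> bool" where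
  "ortho_proj P \<longleftrightarrow> linear P \<and> (\<forall>x. P (P x) = P x) \<and> (\<forall>x y. inner (P x) y = inner x (P y))"

lemma ortho_projD:
  assumes "ortho_proj P"
  shows "linear P" "P (P x) = P x" "inner (P x) y = inner x (P y)"
    "P (x + y) = P x + P y" "P (x - y) = P x - P y" "P 0 = 0" "P (c *\<^sub>R x) = c *\<^sub>R P x"
  using assms by (auto simp: ortho_proj_def linear_add linear_diff linear_0 linear_scale)

lemma ortho_proj_inner:
  assumes "ortho_proj P"
  shows "inner (P x) x = (norm (P x))\<^sup>2"
  by (metis assms ortho_projD(2,3) power2_norm_eq_inner)

lemma ortho_proj_norm_le:
  assumes "ortho_proj P"
  shows "norm (P x) \<le> norm x"
  using norm_cauchy_schwarz[of "P x" x] ortho_proj_inner[OF assms, of x]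
  by (intro norm_le_if_square_le) (simp add: mult.commute)

lemma ortho_proj_bounded_linear: "ortho_proj P \<Longrightarrow> bounded_linear P"
  by (rule bounded_linear_intro[where K = 1]) (auto simp: ortho_projD ortho_proj_norm_le)

text \<open>Both operators are symmetric, so this is the adjoint of the assumed identity.\<close>

lemma ortho_proj_absorb_sym:
  assumes "ortho_proj P" "ortho_proj Q" "\<And>x. P (Q x) = P x"
  shows "Q (P x) = P x"
proof -
  have "inner (Q (P x) - P x) y = 0" for y
    using assms by (simp add: inner_diff_left ortho_projD(3))
  then show ?thesis
    by (metis inner_eq_zero_iff right_minus_eq)
qed

lemma ortho_proj_diff:
  assumes "ortho_proj P" "ortho_proj Q" "\<And>x. P (Q x) = P x" "\<And>x. Q (P x) = P x"
  shows "ortho_proj (\<lambda>x. Q x - P x)"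
  using assms unfolding ortho_proj_def
  by (auto intro!: linear_compose_sub simp: linear_diff inner_diff_left inner_diff_right)

definition proj_on :: "'a::{real_inner,banach} set \<Rightarrow> 'a \<Rightarrow> 'a" where
  "proj_on M x = (SOME y. y \<in> M \<and> (\<forall>z\<in>M. inner (x - y) z = 0))"

context
  fixes M :: "'a::{real_inner,banach} set"
  assumes clM: "closed M" and subM: "subspace M"
begin

lemma proj_on: "proj_on M x \<in> M" "z \<in> M \<Longrightarrow> inner (x - proj_on M x) z = 0"
proof -
  have "\<exists>y. y \<in> M \<and> (\<forall>z\<in>M. inner (x - y) z = 0)"
    using orthogonal_decomposition[OF clM subM, of x] by blast
  from someI_ex[OF this] show "proj_on M x \<in> M" "z \<in> M \<Longrightarrow> inner (x - proj_on M x) z = 0"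
    by (auto simp: proj_on_def)
qed

lemma proj_on_eqI:
  assumes "y \<in> M" "\<And>z. z \<in> M \<Longrightarrow> inner (x - y) z = 0"
  shows "proj_on M x = y"
proof -
  have m: "proj_on M x - y \<in> M"
    using assms(1) proj_on(1) subM by (simp add: subspace_diff)
  have "inner (proj_on M x - y) (proj_on M x - y) =
      inner (x - y) (proj_on M x - y) - inner (x - proj_on M x) (proj_on M x - y)"
    by (simp add: inner_diff_left)
  then show ?thesis
    using assms(2)[OF m] proj_on(2)[OF m] by simp
qed

lemma proj_on_in: "x \<in> M \<Longrightarrow> proj_on M x = x"
  by (rule proj_on_eqI) auto

lemma ortho_proj_proj_on: "ortho_proj (proj_on M)"
  unfolding ortho_proj_def
proof (intro conjI allI)
  show "linear (proj_on M)"
  proof (rule linearI)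
    fix x y :: 'a and c :: real
    show "proj_on M (x + y) = proj_on M x + proj_on M y"
    proof (rule proj_on_eqI)
      fix z assume "z \<in> M"
      then show "inner (x + y - (proj_on M x + proj_on M y)) z = 0"
        using proj_on(2)[of z x] proj_on(2)[of z y] by (simp add: inner_diff_left inner_add_left)
    qed (simp add: proj_on subM subspace_add)
    show "proj_on M (c *\<^sub>R x) = c *\<^sub>R proj_on M x"
    proof (rule proj_on_eqI)
      fix z assume "z \<in> M"
      then show "inner (c *\<^sub>R x - c *\<^sub>R proj_on M x) z = 0"
        using proj_on(2)[of z x] by (simp add: inner_diff_left)
    qed (simp add: proj_on subM subspace_scale)
  qed
  fix x y
  show "proj_on M (proj_on M x) = proj_on M x"
    by (simp add: proj_on_in proj_on)
  show "inner (proj_on M x) y = inner x (proj_on M y)"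
    using proj_on(2)[OF proj_on(1), of x y] proj_on(2)[OF proj_on(1), of y x]
    by (simp add: inner_diff_left inner_diff_right inner_commute)
qed

text \<open>Invariance of \<open>M\<close> under the adjoint \<open>K'\<close> means that
  \<open>K\<close> preserves the orthogonal complement as well, so \<open>K\<close> respects the
  decomposition of \<open>x\<close>.\<close>

lemma proj_on_commute:
  assumes "linear K" and adj: "\<And>x y. inner (K x) y = inner x (K' y)"
    and "\<And>x. x \<in> M \<Longrightarrow> K x \<in> M" "\<And>x. x \<in> M \<Longrightarrow> K' x \<in> M"
  shows "proj_on M (K x) = K (proj_on M x)"
proof (rule proj_on_eqI)
  fix z assume "z \<in> M"
  then show "inner (K x - K (proj_on M x)) z = 0"
    using assms proj_on by (simp flip: linear_diff[OF \<open>linear K\<close>] add: adj)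
qed (simp add: assms proj_on)

end

text \<open>Coercivity makes \<open>A\<close> bounded below, hence its range closed. The residual
  \<open>x - y\<close> of the projection onto the range is orthogonal to its own image, so
  coercivity kills it.\<close>

lemma coercive_surj:
  fixes A :: "'a::{real_inner,banach} \<Rightarrow> 'a"
  assumes A: "bounded_linear A" and sym: "\<And>x y. inner (A x) y = inner x (A y)"
    and coer: "\<And>x. (norm x)\<^sup>2 \<le> inner (A x) x"
  shows "\<exists>y. A y = x"
proof -
  have lower: "norm x \<le> norm (A x)" for x
    using coer[of x] norm_cauchy_schwarz[of "A x" x] by (intro norm_le_if_square_le) linarith
  have "complete (A ` UNIV)"
    using lower by (intro complete_isometric_image[of 1] A) (auto simp: complete_UNIV)
  then have cl: "closed (range A)"
    by (rule complete_imp_closed)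
  have sub: "subspace (range A)"
    using A by (simp add: bounded_linear.linear linear_subspace_image)
  obtain y where y: "y \<in> range A" "\<And>z. z \<in> range A \<Longrightarrow> inner (x - y) z = 0"
    using orthogonal_decomposition[OF cl sub, of x] by blast
  have "inner (A (x - y)) (x - y) = 0"
    using y(2)[of "A (x - y)"] by (simp add: inner_commute)
  then have "x = y"
    using coer[of "x - y"] by simp
  with y(1) show ?thesis by blast
qed

section \<open>A projection separating a positive operator at level one\<close>

text \<open>The bound may depend on \<open>x\<close>, which makes invariance under commuting
  operators easy. For positive \<open>Z\<close>, \<open>pow_norm_le\<close> improves it to
  \<open>norm x\<close>, which makes the set closed.\<close>

definition power_bounded :: "('a::real_inner \<Rightarrow> 'a) \<Rightarrow> 'a set" where
  "power_bounded Z = {x. \<exists>C. \<forall>n. norm ((Z ^^ n) x) \<le> C}"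

locale positive_operator =
  fixes Z :: "'a::{real_inner,banach} \<Rightarrow> 'a"
  assumes bounded_linear: "bounded_linear Z"
    and sym: "inner (Z x) y = inner x (Z y)"
    and pos: "0 \<le> inner (Z x) x"
begin

lemma bounded_linear_pow: "bounded_linear (Z ^^ n)"
  by (induction n) (auto simp: o_def id_def intro: bounded_linear_ident bounded_linear_compose[OF bounded_linear])

lemma sym_pow: "inner ((Z ^^ n) x) y = inner x ((Z ^^ n) y)"
  by (induction n arbitrary: x y) (simp_all add: sym funpow_swap1)

lemma inner_pow_add: "inner ((Z ^^ (m + n)) x) y = inner ((Z ^^ n) x) ((Z ^^ m) y)"
  by (simp add: funpow_add sym_pow)

lemma pos_pow: "0 \<le> inner ((Z ^^ n) x) x"
proof (cases "even n")
  case True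
  then obtain k where "n = k + k" by (metis evenE mult_2)
  then show ?thesis by (simp add: inner_pow_add)
next
  case False
  then obtain k where "n = k + Suc k" by (metis oddE mult_2 add_Suc_right Suc_eq_plus1)
  then show ?thesis by (simp only: inner_pow_add funpow.simps o_def pos)
qed

text \<open>By symmetry the squared norm of \<open>(Z ^^ n) x\<close> pairs
  \<open>(Z ^^ (n + n)) x\<close> with \<open>x\<close>. The supremum \<open>S\<close> of the orbit
  norms therefore satisfies \<open>S\<^sup>2 \<le> S * norm x\<close>.\<close>

lemma pow_norm_le:
  assumes "x \<in> power_bounded Z"
  shows "norm ((Z ^^ n) x) \<le> norm x"
proof -
  define S where "S = (SUP n. norm ((Z ^^ n) x))"
  obtain C where C: "\<And>n. norm ((Z ^^ n) x) \<le> C"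
    using assms by (auto simp: power_bounded_def)
  then have upper: "norm ((Z ^^ n) x) \<le> S" for n
    unfolding S_def by (intro cSUP_upper) (auto intro: bdd_aboveI[of _ C])
  have "norm ((Z ^^ n) x) \<le> sqrt (S * norm x)" for n
  proof -
    have "(norm ((Z ^^ n) x))\<^sup>2 = inner ((Z ^^ (n + n)) x) x"
      by (simp add: inner_pow_add power2_norm_eq_inner)
    also have "\<dots> \<le> norm ((Z ^^ (n + n)) x) * norm x"
      by (rule norm_cauchy_schwarz)
    also have "\<dots> \<le> S * norm x"
      by (intro mult_right_mono upper) auto
    finally show ?thesis
      by (rule real_le_rsqrt)
  qed
  then have "S \<le> sqrt (S * norm x)"
    unfolding S_def by (intro cSUP_least) auto
  moreover have "0 \<le> S"
    using upper[of 0] norm_ge_zero order_trans by blast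
  ultimately have "S\<^sup>2 \<le> S * norm x"
    by (metis power_mono norm_ge_zero real_sqrt_pow2 mult_nonneg_nonneg)
  then have "S \<le> norm x"
    using \<open>0 \<le> S\<close> by (cases "S = 0") (auto simp: power2_eq_square)
  with upper[of n] show ?thesis by linarith
qed

lemma power_bounded_inner_le:
  assumes "x \<in> power_bounded Z"
  shows "inner (Z x) x \<le> (norm x)\<^sup>2"
proof -
  have "inner (Z x) x \<le> norm (Z x) * norm x"
    by (rule norm_cauchy_schwarz)
  also have "\<dots> \<le> norm x * norm x"
    using pow_norm_le[OF assms, of 1] by (intro mult_right_mono) auto
  finally show ?thesis by (simp add: power2_eq_square)
qed

lemma subspace_power_bounded: "subspace (power_bounded Z)"
  unfolding subspace_def
proof (intro conjI ballI allI)
  note lin = bounded_linear.linear[OF bounded_linear_pow]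
  show "0 \<in> power_bounded Z"
    by (auto simp: power_bounded_def linear_0[OF lin])
  fix x assume x: "x \<in> power_bounded Z"
  show "c *\<^sub>R x \<in> power_bounded Z" for c
    using pow_norm_le[OF x]
    by (auto simp: power_bounded_def linear_scale[OF lin]
        intro!: exI[of _ "\<bar>c\<bar> * norm x"] mult_left_mono)
  fix y assume y: "y \<in> power_bounded Z"
  show "x + y \<in> power_bounded Z"
    using pow_norm_le[OF x] pow_norm_le[OF y]
    by (auto simp: power_bounded_def linear_add[OF lin]
        intro!: exI[of _ "norm x + norm y"] norm_triangle_le add_mono)
qed

lemma closed_power_bounded: "closed (power_bounded Z)"
proof -
  have "power_bounded Z = (\<Inter>n. {x. norm ((Z ^^ n) x) \<le> norm x})"
  proof (intro set_eqI iffI)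
    fix x assume "x \<in> (\<Inter>n. {x. norm ((Z ^^ n) x) \<le> norm x})"
    then show "x \<in> power_bounded Z"
      by (auto simp: power_bounded_def intro!: exI[of _ "norm x"])
  qed (auto intro: pow_norm_le)
  moreover have "closed {x. norm ((Z ^^ n) x) \<le> norm x}" for n
    using linear_continuous_on[OF bounded_linear_pow, of UNIV n]
    by (intro closed_Collect_le continuous_intros) auto
  ultimately show ?thesis by auto
qed

lemma power_bounded_invariant:
  assumes K: "bounded_linear K" and comm: "\<And>x. Z (K x) = K (Z x)"
    and x: "x \<in> power_bounded Z"
  shows "K x \<in> power_bounded Z"
proof -
  have pow: "(Z ^^ n) (K x) = K ((Z ^^ n) x)" for n
    by (induction n) (simp_all add: comm)
  obtain C where C: "\<And>n. norm ((Z ^^ n) x) \<le> C"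
    using x by (auto simp: power_bounded_def)
  obtain B where "0 < B" and B: "\<And>y. norm (K y) \<le> norm y * B"
    using bounded_linear.pos_bounded[OF K] by blast
  have "norm ((Z ^^ n) (K x)) \<le> C * B" for n
    unfolding pow using B[of "(Z ^^ n) x"] C[of n] \<open>0 < B\<close> mult_right_mono[of _ C B]
    by (meson less_imp_le order_trans)
  then show ?thesis by (auto simp: power_bounded_def)
qed

text \<open>
  The inverses \<open>y n\<close> of \<open>1 + Z + \<dots> + Z\<^sup>n\<close> applied to \<open>x\<close> form a decreasing sequence of positive
  operators (in terms of the spectral calculus, the limit is the positive part of \<open>1 - Z\<close>). The limit
  lies in the power bounded subspace, hence vanishes when \<open>x\<close> is orthogonal to it, and the geometric
  sum \<open>(1 - Z) x = y n - Z\<^sup>n\<^sup>+\<^sup>1 (y n)\<close> shows that \<open>1 - Z\<close> is negative at \<open>x\<close>.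
\<close>

lemma power_bounded_complement_inner_ge:
  assumes x: "\<And>z. z \<in> power_bounded Z \<Longrightarrow> inner x z = 0"
  shows "(norm x)\<^sup>2 \<le> inner (Z x) x"
proof -
  define A where "A n x = (\<Sum>k\<le>n. (Z ^^ k) x)" for n x
  have blA: "bounded_linear (A n)" for n
    unfolding A_def by (intro bounded_linear_sum bounded_linear_pow)
  have symA: "inner (A n u) v = inner u (A n v)" for n u v
    by (simp add: A_def inner_sum_left inner_sum_right sym_pow)
  have monoA: "inner (A m u) u \<le> inner (A n u) u" if "m \<le> n" for m n u
    unfolding A_def inner_sum_left using that pos_pow by (intro sum_mono2) auto
  have coerA: "(norm u)\<^sup>2 \<le> inner (A n u) u" for n u
    using monoA[of 0 n u] by (simp add: A_def power2_norm_eq_inner)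
  have commA: "Z (A n u) = A n (Z u)" for n u
    unfolding A_def linear_sum[OF bounded_linear.linear[OF bounded_linear]]
    by (rule sum.cong[OF refl]) (rule funpow_swap1)
  have "\<exists>y. A n y = u" for n u
    by (rule coercive_surj[OF blA symA coerA])
  then obtain R where R: "A n (R n u) = u" for n u
    by metis
  have uniq: "u = v" if "A n u = A n v" for n u v
  proof -
    have "A n (u - v) = 0"
      using that blA[of n] by (simp add: linear_diff bounded_linear.linear)
    then show ?thesis using coerA[of "u - v" n] by simp
  qed
  define y where "y n = R n x" for n
  define q where "q n = inner x (y n)" for n
  have Ay: "A n (y n) = x" for n
    by (simp add: y_def R)
  have q_eq: "q n = inner (A n (y n)) (y n)" for n
    by (simp add: q_def Ay)
  have y_le: "(norm (y n))\<^sup>2 \<le> q n" for n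
    using coerA[of "y n" n] by (simp add: q_eq)
  have q_le: "q n \<le> (norm x)\<^sup>2" for n
  proof -
    have "q n \<le> norm x * norm (y n)"
      unfolding q_def by (rule norm_cauchy_schwarz)
    moreover have "norm (y n) \<le> norm x"
      using calculation y_le[of n] by (intro norm_le_if_square_le) linarith
    ultimately show ?thesis
      by (metis mult_left_mono norm_ge_zero order_trans power2_eq_square)
  qed
  \<comment> \<open>The form of \<open>A m\<close> dominates the squared distance. Expanding it with
    \<open>A m (y m) = x\<close> and replacing \<open>A m\<close> by the larger \<open>A n\<close>
    in the last term leaves a difference of the monotone sequence \<open>q\<close>.\<close>
  have diff_le: "(norm (y m - y n))\<^sup>2 \<le> q m - q n" if "m \<le> n" for m n
  proof -
    have "(norm (y m - y n))\<^sup>2 \<le> inner (A m (y m - y n)) (y m - y n)"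
      by (rule coerA)
    also have "\<dots> = q m - 2 * q n + inner (A m (y n)) (y n)"
      using symA[of m "y n" "y m"] blA[of m]
      by (simp add: linear_diff bounded_linear.linear inner_diff_left inner_diff_right
          Ay q_def inner_commute)
    also have "\<dots> \<le> q m - q n"
      using monoA[OF that, of "y n"] by (simp add: q_eq)
    finally show ?thesis .
  qed
  have "decseq q"
  proof (rule decseq_SucI)
    show "q (Suc n) \<le> q n" for n
      using order_trans[OF zero_le_power2 diff_le[of n "Suc n"]] by simp
  qed
  moreover have "0 \<le> q n" for n
    using y_le[of n] zero_le_power2 order_trans by blast
  ultimately obtain l where "q \<longlonglongrightarrow> l"
    using decseq_convergent by blast
  then have "Cauchy q"
    by (rule LIMSEQ_imp_Cauchy)
  have "Cauchy y"
  proof (rule CauchyI)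
    fix e :: real assume "e > 0"
    then have "0 < e\<^sup>2" by simp
    then obtain N where N: "\<And>m n. m \<ge> N \<Longrightarrow> n \<ge> N \<Longrightarrow> norm (q m - q n) < e\<^sup>2"
      using CauchyD[OF \<open>Cauchy q\<close>] by metis
    have *: "norm (y m - y n) < e" if "m \<ge> N" "n \<ge> N" "m \<le> n" for m n
    proof -
      have "(norm (y m - y n))\<^sup>2 < e\<^sup>2"
        using diff_le[OF that(3)] N[OF that(1,2)] by auto
      then show ?thesis
        using \<open>e > 0\<close> power2_less_imp_less by fastforce
    qed
    have "norm (y m - y n) < e" if "m \<ge> N" "n \<ge> N" for m n
      using *[of m n] *[of n m] that by (cases "m \<le> n") (auto simp: norm_minus_commute)
    then show "\<exists>N. \<forall>m\<ge>N. \<forall>n\<ge>N. norm (y m - y n) < e"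
      by blast
  qed
  then obtain y0 where y0: "y \<longlonglongrightarrow> y0"
    using Cauchy_convergent_iff convergent_def by blast
  have "norm ((Z ^^ k) y0) \<le> norm x" for k
  proof (rule LIMSEQ_le_const2)
    show "(\<lambda>n. norm ((Z ^^ k) (y n))) \<longlonglongrightarrow> norm ((Z ^^ k) y0)"
      by (intro tendsto_norm bounded_linear.tendsto[OF bounded_linear_pow] y0)
    \<comment> \<open>All terms of the form of \<open>A n\<close> at \<open>y n\<close> are
      nonnegative and their sum is \<open>q n\<close>. The term of exponent \<open>k + k\<close>,
      present once \<open>n \<ge> k + k\<close>, is the squared norm in question.\<close>
    have "norm ((Z ^^ k) (y n)) \<le> norm x" if "n \<ge> k + k" for n
    proof -
      have "(norm ((Z ^^ k) (y n)))\<^sup>2 = inner ((Z ^^ (k + k)) (y n)) (y n)"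
        by (simp add: inner_pow_add power2_norm_eq_inner)
      also have "\<dots> \<le> inner (A n (y n)) (y n)"
        unfolding A_def inner_sum_left
        using that pos_pow by (intro member_le_sum) auto
      also have "\<dots> \<le> (norm x)\<^sup>2"
        using q_le q_eq by simp
      finally show ?thesis by (simp add: power2_le_iff_abs_le)
    qed
    then show "\<exists>N. \<forall>n\<ge>N. norm ((Z ^^ k) (y n)) \<le> norm x" by blast
  qed
  then have y0_in: "y0 \<in> power_bounded Z"
    by (auto simp: power_bounded_def)
  \<comment> \<open>The inverse of \<open>A n\<close> is symmetric and preserves the power bounded
    subspace, so \<open>y n\<close> inherits from \<open>x\<close> the orthogonality to it. The
    limit \<open>y0\<close> is then orthogonal to itself.\<close>
  have "inner (y n) z = 0" if z: "z \<in> power_bounded Z" for n z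
  proof -
    have "norm ((Z ^^ k) (R n z)) \<le> norm z" for k
    proof -
      have pow: "A n ((Z ^^ k) u) = (Z ^^ k) (A n u)" for u
        by (induction k) (simp_all flip: commA)
      have "norm u \<le> norm (A n u)" for u
        using coerA[of u n] norm_cauchy_schwarz[of "A n u" u] by (intro norm_le_if_square_le) linarith
      from this[of "(Z ^^ k) (R n z)"] show ?thesis
        using pow_norm_le[OF z, of k] by (simp add: pow R)
    qed
    then have "R n z \<in> power_bounded Z"
      by (auto simp: power_bounded_def)
    moreover have "inner (y n) z = inner x (R n z)"
      by (metis Ay R symA)
    ultimately show ?thesis using x by simp
  qed
  then have "(\<lambda>n. inner (y n) y0) \<longlonglongrightarrow> 0"
    using y0_in by simp
  then have "inner y0 y0 = 0"
    using tendsto_inner[OF y0 tendsto_const] LIMSEQ_unique by blast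
  then have "(\<lambda>n. inner (y n) x) \<longlonglongrightarrow> 0"
    using tendsto_inner[OF y0 tendsto_const[of x]] by simp
  moreover have "(norm x)\<^sup>2 - inner (Z x) x \<le> inner (y n) x" for n
  proof -
    have "x - Z x = A n (y n) - A n (Z (y n))"
      by (simp add: Ay flip: commA)
    also have "\<dots> = y n - (Z ^^ Suc n) (y n)"
      using sum_telescope[of "\<lambda>k. (Z ^^ k) (y n)" n]
      by (simp add: A_def funpow_swap1 sum_subtractf)
    finally have *: "x - Z x = y n - (Z ^^ Suc n) (y n)" .
    have "inner ((Z ^^ Suc n) (y n)) x = inner ((Z ^^ Suc n) (y n)) (A n (y n))"
      by (simp add: Ay)
    also have "\<dots> = (\<Sum>k\<le>n. inner ((Z ^^ (k + Suc n)) (y n)) (y n))"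
      unfolding A_def inner_sum_right by (simp only: inner_pow_add)
    also have "\<dots> \<ge> 0"
      by (intro sum_nonneg pos_pow)
    finally have "inner (x - Z x) x \<le> inner (y n) x"
      by (simp only: * inner_diff_left)
    then show ?thesis
      by (simp add: inner_diff_left power2_norm_eq_inner)
  qed
  ultimately have "(norm x)\<^sup>2 - inner (Z x) x \<le> 0"
    by (intro LIMSEQ_le_const) auto
  then show ?thesis by simp
qed

end

section \<open>Self-adjoint operators on real Hilbert spaces\<close>

text \<open>The inclusion of \<open>K T\<close> in \<open>T K\<close> as unbounded operators, which
  is the right notion for bounded \<open>K\<close>.\<close>

definition commutes_with :: "('a \<Rightarrow> 'a) \<Rightarrow> 'a set \<Rightarrow> ('a \<Rightarrow> 'a) \<Rightarrow> bool" where
  "commutes_with K D T \<longleftrightarrow> (\<forall>x\<in>D. K x \<in> D \<and> T (K x) = K (T x))"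

lemma commutes_withD:
  assumes "commutes_with K D T" "x \<in> D"
  shows "K x \<in> D" "T (K x) = K (T x)"
  using assms by (auto simp: commutes_with_def)

lemma commutes_with_shift:
  fixes K :: "'a::real_vector \<Rightarrow> 'a"
  assumes "linear K"
  shows "commutes_with K D (\<lambda>x. T x - c *\<^sub>R x) \<longleftrightarrow> commutes_with K D T"
  using assms by (auto simp: commutes_with_def linear_diff linear_scale)

definition square_resolvent :: "'a::real_inner set \<Rightarrow> ('a \<Rightarrow> 'a) \<Rightarrow> 'a \<Rightarrow> 'a" where
  "square_resolvent D T h = (THE f. f \<in> D \<and> T f \<in> D \<and> f + T (T f) = h)"

text \<open>In spectral terms \<open>Z\<close> is the function 1 + t / (1 + t^2), which is at most 1
  exactly for t \<le> 0. This is thus the spectral projection of \<open>T\<close> for the closed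
  half-line up to 0.\<close>

definition nonpositive_proj :: "'a::{real_inner,banach} set \<Rightarrow> ('a \<Rightarrow> 'a) \<Rightarrow> 'a \<Rightarrow> 'a" where
  "nonpositive_proj D T = proj_on (power_bounded (\<lambda>x. x + T (square_resolvent D T x)))"

text \<open>The assumption says that the graph of \<open>T\<close> is the graph of its adjoint.\<close>

locale real_self_adjoint =
  fixes D :: "'a::{real_inner,banach} set" and T :: "'a \<Rightarrow> 'a"
  assumes adjoint: "(\<forall>x\<in>D. inner (T x) y = inner x z) \<longleftrightarrow> y \<in> D \<and> T y = z"
begin

lemma symmetric: "x \<in> D \<Longrightarrow> y \<in> D \<Longrightarrow> inner (T x) y = inner x (T y)"
  using adjoint by blast

text \<open>Domain membership and value are obtained together by testing against \<open>D\<close>.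
  Even the linearity of \<open>T\<close> is derived this way.\<close>

lemma adjointI:
  assumes "\<And>x. x \<in> D \<Longrightarrow> inner (T x) y = inner x z"
  shows "y \<in> D" "T y = z"
  using assms adjoint by blast+

lemma domain_0: "0 \<in> D" "T 0 = 0"
  by (rule adjointI[where z = 0]; simp)+

text \<open>Orthogonality to \<open>D\<close> puts \<open>(0, w)\<close> into the graph of the
  adjoint, which is the graph of \<open>T\<close>; but \<open>T 0 = 0\<close>.\<close>

lemma domain_dense:
  assumes "\<And>x. x \<in> D \<Longrightarrow> inner x w = 0"
  shows "w = 0"
  using adjointI(2)[of 0 w] assms domain_0 by simp

lemma domain_add:
  assumes "x \<in> D" "y \<in> D"
  shows "x + y \<in> D" "T (x + y) = T x + T y"
  by (rule adjointI[where z = "T x + T y"]; use assms in \<open>simp add: inner_add_right symmetric\<close>)+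

lemma domain_diff:
  assumes "x \<in> D" "y \<in> D"
  shows "x - y \<in> D" "T (x - y) = T x - T y"
  by (rule adjointI[where z = "T x - T y"]; use assms in \<open>simp add: inner_diff_right symmetric\<close>)+

lemma domain_scaleR:
  assumes "x \<in> D"
  shows "c *\<^sub>R x \<in> D" "T (c *\<^sub>R x) = c *\<^sub>R T x"
  by (rule adjointI[where z = "c *\<^sub>R T x"]; use assms in \<open>simp add: symmetric\<close>)+

text \<open>Transfers every result about the level 0 to an arbitrary real level
  \<open>c\<close>.\<close>

lemma shift: "real_self_adjoint D (\<lambda>x. T x - c *\<^sub>R x)"
proof
  fix y z
  have "(\<forall>x\<in>D. inner (T x - c *\<^sub>R x) y = inner x z) \<longleftrightarrow> (\<forall>x\<in>D. inner (T x) y = inner x (z + c *\<^sub>R y))"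
    by (auto simp: inner_diff_left inner_add_right algebra_simps)
  then show "(\<forall>x\<in>D. inner (T x - c *\<^sub>R x) y = inner x z) \<longleftrightarrow> y \<in> D \<and> T y - c *\<^sub>R y = z"
    unfolding adjoint by (auto simp: algebra_simps)
qed

text \<open>Projecting \<open>(h, 0)\<close> onto the graph of \<open>T\<close> inverts \<open>1 + T\<^sup>2\<close>.\<close>

lemma square_resolvent_exists: "\<exists>f. f \<in> D \<and> T f \<in> D \<and> f + T (T f) = h"
proof -
  \<comment> \<open>The graph is described through the adjoint relation, a family of continuous
    linear equations, so that it is visibly a closed subspace.\<close>
  define M where "M = {p. \<forall>x\<in>D. inner (T x) (fst p) = inner x (snd p)}"
  have M: "p \<in> M \<longleftrightarrow> fst p \<in> D \<and> T (fst p) = snd p" for p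
    by (simp add: M_def adjoint)
  have "M = (\<Inter>x\<in>D. {p. inner (T x) (fst p) = inner x (snd p)})"
    by (auto simp: M_def)
  then have "closed M"
    by (auto intro!: closed_INT closed_Collect_eq continuous_intros)
  moreover have "subspace M"
    unfolding subspace_def M_def by (simp add: inner_add_right)
  ultimately obtain p where p: "p \<in> M" "\<And>q. q \<in> M \<Longrightarrow> inner ((h, 0) - p) q = 0"
    using orthogonal_decomposition[of M "(h, 0)"] by blast
  have p_eq: "fst p \<in> D" "snd p = T (fst p)"
    using p(1) M by auto
  \<comment> \<open>Orthogonality of the residual to \<open>(x, T x)\<close> is exactly the adjoint
    relation that places \<open>T (fst p)\<close> in \<open>D\<close>.\<close>
  have "inner (T x) (T (fst p)) = inner x (h - fst p)" if "x \<in> D" for x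
    using p(2)[of "(x, T x)"] that M
    by (simp add: inner_prod_def p_eq inner_diff_left inner_diff_right inner_commute)
  from adjointI[OF this] have "T (fst p) \<in> D" "T (T (fst p)) = h - fst p"
    by simp_all
  with p_eq show ?thesis by (intro exI[of _ "fst p"]) auto
qed

lemma inner_one_plus_square:
  assumes "f \<in> D" "T f \<in> D"
  shows "inner (f + T (T f)) f = (norm f)\<^sup>2 + (norm (T f))\<^sup>2"
  using symmetric[OF assms(2,1)] by (simp add: inner_add_left power2_norm_eq_inner)

lemma square_resolvent_unique:
  assumes "f \<in> D" "T f \<in> D" "f + T (T f) = h" "g \<in> D" "T g \<in> D" "g + T (T g) = h"
  shows "f = g"
proof -
  have "(f - g) + T (T (f - g)) = 0"
    using assms by (simp add: domain_diff algebra_simps)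
  moreover have "f - g \<in> D" "T (f - g) \<in> D"
    using assms by (simp_all add: domain_diff)
  ultimately have "(norm (f - g))\<^sup>2 + (norm (T (f - g)))\<^sup>2 = 0"
    using inner_one_plus_square[of "f - g"] by (simp only: inner_zero_left)
  then show ?thesis
    by (simp add: sum_power2_eq_zero_iff)
qed

section \<open>The bounded operators (1 + T^2)^-1 and T (1 + T^2)^-1\<close>

abbreviation B :: "'a \<Rightarrow> 'a" where "B \<equiv> square_resolvent D T"

abbreviation C :: "'a \<Rightarrow> 'a" where "C h \<equiv> T (B h)"

lemma B: "B h \<in> D" "C h \<in> D" "B h + T (C h) = h"
proof -
  have "\<exists>!f. f \<in> D \<and> T f \<in> D \<and> f + T (T f) = h"
    using square_resolvent_exists square_resolvent_unique by blast
  from theI'[OF this] show "B h \<in> D" "C h \<in> D" "B h + T (C h) = h"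
    by (simp_all add: square_resolvent_def)
qed

lemma B_eqI: "f \<in> D \<Longrightarrow> T f \<in> D \<Longrightarrow> f + T (T f) = h \<Longrightarrow> B h = f"
  by (rule square_resolvent_unique[of _ h]) (auto simp: B)

lemma B_add: "B (x + y) = B x + B y"
proof (rule B_eqI)
  show "B x + B y + T (T (B x + B y)) = x + y"
    using B(3)[of x] B(3)[of y] by (simp add: domain_add B algebra_simps)
qed (simp_all add: domain_add B)

lemma B_scaleR: "B (c *\<^sub>R x) = c *\<^sub>R B x"
  by (rule B_eqI) (simp_all add: domain_scaleR B flip: scaleR_add_right)

lemma B_norm_sum: "(norm (B h))\<^sup>2 + (norm (C h))\<^sup>2 = inner h (B h)"
  using inner_one_plus_square[of "B h"] by (simp add: B)

lemma B_norm_le: "norm (B h) \<le> norm h"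
proof (rule norm_le_if_square_le)
  show "(norm (B h))\<^sup>2 \<le> norm h * norm (B h)"
    using B_norm_sum[of h] norm_cauchy_schwarz[of h "B h"] zero_le_power2[of "norm (C h)"] by linarith
qed

lemma C_norm_le: "norm (C h) \<le> norm h"
proof -
  have "(norm (C h))\<^sup>2 \<le> norm h * norm (B h)"
    using B_norm_sum[of h] norm_cauchy_schwarz[of h "B h"] zero_le_power2[of "norm (B h)"] by linarith
  also have "\<dots> \<le> (norm h)\<^sup>2"
    using B_norm_le[of h] by (simp add: mult_left_mono power2_eq_square)
  finally show ?thesis by simp
qed

lemma C_linear: "linear C"
  by (rule linearI) (simp_all add: B_add B_scaleR domain_add domain_scaleR B)

lemma B_bounded_linear: "bounded_linear B"
  using B_norm_le by (intro bounded_linear_intro[where K = 1]) (auto simp: B_add B_scaleR)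

lemma C_bounded_linear: "bounded_linear C"
  using C_norm_le linear_add[OF C_linear] linear_scale[OF C_linear]
  by (intro bounded_linear_intro[where K = 1]) auto

text \<open>Split \<open>y\<close> as \<open>B y + T (C y)\<close>, move \<open>T\<close> across,
  and reassemble \<open>x\<close> from \<open>B x + T (C x)\<close>.\<close>

lemma C_symmetric: "inner (C x) y = inner x (C y)"
proof -
  have "inner (C x) y = inner (C x) (B y) + inner (C x) (T (C y))"
    by (simp flip: inner_add_right add: B)
  also have "\<dots> = inner (B x) (C y) + inner (T (C x)) (C y)"
    by (simp add: symmetric B)
  also have "\<dots> = inner x (C y)"
    by (simp flip: inner_add_left add: B)
  finally show ?thesis .
qed

text \<open>For \<open>x\<close> in \<open>D\<close> also \<open>T (C x) = x - B x\<close> lies in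
  \<open>D\<close>. Applying \<open>T\<close> to \<open>B x + T (C x) = x\<close> then shows that
  \<open>C x\<close> solves the equation defining \<open>B (T x)\<close>.\<close>

lemma B_commutes: "commutes_with B D T"
  unfolding commutes_with_def
proof (intro ballI conjI)
  fix x assume x: "x \<in> D"
  have D2: "T (C x) \<in> D"
    using domain_diff(1)[OF x B(1)] B(3)[of x] by (metis add_diff_cancel_left')
  show "T (B x) = B (T x)"
    using domain_add(2)[OF B(1)[of x] D2] B(3)[of x] by (intro B_eqI[symmetric]) (simp_all add: B D2)
qed (rule B)

abbreviation Z :: "'a \<Rightarrow> 'a" where "Z \<equiv> \<lambda>x. x + C x"

lemma Z_positive: "positive_operator Z"
proof (rule positive_operator.intro)
  show "bounded_linear Z"
    by (intro bounded_linear_add bounded_linear_ident C_bounded_linear)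
  fix x y
  show "inner (Z x) y = inner x (Z y)"
    by (simp add: inner_add_left inner_add_right C_symmetric)
  have "\<bar>inner (C x) x\<bar> \<le> norm x * norm x"
    by (rule order_trans[OF Cauchy_Schwarz_ineq2]) (simp add: C_norm_le mult_right_mono)
  then show "0 \<le> inner (Z x) x"
    by (simp add: inner_add_left power2_norm_eq_inner flip: power2_eq_square)
qed

section \<open>The spectral projection at level zero\<close>

abbreviation N :: "'a \<Rightarrow> 'a" where "N \<equiv> nonpositive_proj D T"

lemmas N_closed = positive_operator.closed_power_bounded[OF Z_positive]
lemmas N_subspace = positive_operator.subspace_power_bounded[OF Z_positive]

lemma ortho_proj_N: "ortho_proj N"
  unfolding nonpositive_proj_def by (rule ortho_proj_proj_on[OF N_closed N_subspace])

lemma commutes_with_resolvent: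
  assumes "linear K" "commutes_with K D T"
  shows "K (B x) = B (K x)" "K (C x) = C (K x)"
proof -
  have "K (B x) + T (T (K (B x))) = K (B x) + K (T (C x))"
    using assms by (simp add: commutes_withD B)
  also have "\<dots> = K x"
    using assms(1) by (simp flip: linear_add add: B)
  finally have "K (B x) + T (T (K (B x))) = K x" .
  then show "K (B x) = B (K x)"
    using assms B by (intro B_eqI[symmetric]) (simp_all add: commutes_withD)
  then show "K (C x) = C (K x)"
    using commutes_withD(2)[OF assms(2) B(1)] by metis
qed

text \<open>Only commutation with the bounded operator \<open>C\<close> is asked for, so that the
  lemma also covers \<open>B\<close> and \<open>C\<close> themselves, before anything is known about
  \<open>N\<close> and \<open>T\<close>.\<close>

lemma commute_N_aux:
  assumes "bounded_linear K" "bounded_linear K'"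
    and adj: "\<And>x y. inner (K x) y = inner x (K' y)"
    and "\<And>x. C (K x) = K (C x)" "\<And>x. C (K' x) = K' (C x)"
  shows "N (K x) = K (N x)"
  unfolding nonpositive_proj_def
proof (rule proj_on_commute[OF N_closed N_subspace _ adj])
  show "linear K" using assms(1) by (rule bounded_linear.linear)
  show "K x \<in> power_bounded Z" if "x \<in> power_bounded Z" for x
    by (rule positive_operator.power_bounded_invariant[OF Z_positive assms(1) _ that])
      (simp add: assms linear_add bounded_linear.linear)
  show "K' x \<in> power_bounded Z" if "x \<in> power_bounded Z" for x
    by (rule positive_operator.power_bounded_invariant[OF Z_positive assms(2) _ that])
      (simp add: assms linear_add bounded_linear.linear)
qed

lemma commute_N:
  assumes "bounded_linear K" "bounded_linear K'"
    and "\<And>x y. inner (K x) y = inner x (K' y)"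
    and "commutes_with K D T" "commutes_with K' D T"
  shows "N (K x) = K (N x)"
  using assms by (intro commute_N_aux[where K' = K']) (simp_all add: commutes_with_resolvent bounded_linear.linear)

lemma B_symmetric: "inner (B x) y = inner x (B y)"
proof -
  have "inner (B x) y = inner (B x) (B y) + inner (B x) (T (C y))"
    by (simp flip: inner_add_right add: B)
  also have "\<dots> = inner (B x) (B y) + inner (T (C x)) (B y)"
    using symmetric[OF B(1)[of x] B(2)[of y]] symmetric[OF B(2)[of x] B(1)[of y]] by simp
  also have "\<dots> = inner x (B y)"
    by (simp flip: inner_add_left add: B)
  finally show ?thesis .
qed

text \<open>Since \<open>B\<close> commutes with \<open>T\<close>, the summand
  \<open>T (C x)\<close> equals \<open>C (T x)\<close>. This expresses a domain vector by bounded
  operators applied to \<open>x\<close> and \<open>T x\<close>.\<close>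

lemma domain_decompose:
  assumes "x \<in> D"
  shows "x = B x + C (T x)"
  using B(3)[of x] commutes_withD(2)[OF B_commutes] assms B by metis

text \<open>\<open>N\<close> commutes with \<open>B\<close> and \<open>C\<close>. Applied to
  \<open>domain_decompose\<close> this writes \<open>N x\<close> as a sum of values of
  \<open>B\<close> and \<open>C\<close>, all of which lie in \<open>D\<close>.\<close>

lemma N_commutes: "commutes_with N D T"
proof -
  have CB: "C (B x) = B (C x)" for x
    using commutes_withD(2)[OF B_commutes B(1)] .
  have NB: "N (B x) = B (N x)" for x
    by (rule commute_N_aux[OF B_bounded_linear B_bounded_linear B_symmetric CB CB])
  have NC: "N (C x) = C (N x)" for x
    by (rule commute_N_aux[OF C_bounded_linear C_bounded_linear C_symmetric refl refl])
  note linN = ortho_projD[OF ortho_proj_N]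
  show ?thesis
    unfolding commutes_with_def
  proof (intro ballI conjI)
    fix x assume x: "x \<in> D"
    have N_eq: "N x = B (N x) + C (N (T x))"
      using arg_cong[OF domain_decompose[OF x], of N] by (simp add: linN(4) NB NC)
    then show "N x \<in> D"
      by (metis domain_add(1) B(1,2))
    have "T (N x) = C (N x) + T (C (N (T x)))"
      by (subst N_eq) (simp add: domain_add B)
    also have "\<dots> = N (C x) + (N (T x) - B (N (T x)))"
      using B(3)[of "N (T x)"] by (simp add: NC algebra_simps)
    also have "\<dots> = N (C x) + (N (T x) - N (C x))"
      using commutes_withD(2)[OF B_commutes x] by (simp add: NB)
    finally show "T (N x) = N (T x)" by simp
  qed
qed

lemma inner_decompose:
  assumes "x \<in> D"
  shows "inner (T x) x = inner (C x) x + inner (C (T x)) (T x)"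
proof -
  have "inner (T x) x = inner (T x) (B x) + inner (T x) (C (T x))"
    using domain_decompose[OF assms] by (metis inner_add_right)
  then show ?thesis
    using assms by (simp add: symmetric B inner_commute)
qed

text \<open>The form of \<open>C\<close> is nonpositive on the range of \<open>N\<close>, which
  contains \<open>T x\<close> along with \<open>x\<close>; \<open>inner_decompose\<close> adds the
  two contributions.\<close>

lemma N_nonpositive:
  assumes "x \<in> D" "N x = x"
  shows "inner (T x) x \<le> 0"
proof -
  have "inner (C y) y \<le> 0" if "N y = y" for y
  proof -
    have "y \<in> power_bounded Z"
      using proj_on(1)[OF N_closed N_subspace, of y] that by (simp add: nonpositive_proj_def)
    from positive_operator.power_bounded_inner_le[OF Z_positive this] show ?thesis
      by (simp add: inner_add_left power2_norm_eq_inner)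
  qed
  from this[OF assms(2)] this[of "T x"] show ?thesis
    using assms commutes_withD(2)[OF N_commutes assms(1)] inner_decompose[OF assms(1)] by simp
qed

lemma N_nonnegative:
  assumes "x \<in> D" "N x = 0"
  shows "0 \<le> inner (T x) x"
proof -
  have "0 \<le> inner (C y) y" if "N y = 0" for y
  proof -
    have "inner y z = 0" if "z \<in> power_bounded Z" for z
      using proj_on(2)[OF N_closed N_subspace that, of y] \<open>N y = 0\<close> by (simp add: nonpositive_proj_def)
    from positive_operator.power_bounded_complement_inner_ge[OF Z_positive this] show ?thesis
      by (simp add: inner_add_left power2_norm_eq_inner)
  qed
  from this[OF assms(2)] this[of "T x"] show ?thesis
    using assms commutes_withD(2)[OF N_commutes assms(1)] inner_decompose[OF assms(1)] domain_0 by simp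
qed

text \<open>A vector in the range of \<open>P\<close> and the kernel of \<open>Q\<close> satisfies
  two incompatible form bounds, so it is zero if it lies in \<open>D\<close>. This one comparison
  yields both the monotonicity of the family and its uniqueness.\<close>

lemma proj_comparison:
  assumes P: "ortho_proj P" "commutes_with P D T"
    and Q: "ortho_proj Q" "commutes_with Q D T"
    and PQ: "\<And>x. P (Q x) = Q (P x)"
    and le: "\<And>x. x \<in> D \<Longrightarrow> P x = x \<Longrightarrow> inner (T x) x \<le> c * (norm x)\<^sup>2"
    and ge: "\<And>x. x \<in> D \<Longrightarrow> Q x = 0 \<Longrightarrow> d * (norm x)\<^sup>2 \<le> inner (T x) x"
    and "c < d"
  shows "P (Q x) = P x"
proof -
  note lin = ortho_projD[OF P(1)] ortho_projD[OF Q(1)]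
  have zero: "P (y - Q y) = 0" if y: "y \<in> D" for y
  proof -
    let ?v = "P (y - Q y)"
    have "?v \<in> D"
      using y by (simp add: domain_diff commutes_withD[OF P(2)] commutes_withD[OF Q(2)])
    moreover have "P ?v = ?v" "Q ?v = 0"
      by (simp_all add: lin PQ)
    ultimately have "d * (norm ?v)\<^sup>2 \<le> c * (norm ?v)\<^sup>2"
      using le ge order_trans by blast
    with \<open>c < d\<close> show ?thesis
      by (simp add: mult_le_cancel_right)
  qed
  \<comment> \<open>As \<open>P\<close> and \<open>Q\<close> commute, \<open>P (1 - Q)\<close> is
    symmetric and can be moved onto \<open>y\<close> in \<open>D\<close>, where it is known to
    vanish.\<close>
  have "inner y (P (x - Q x)) = 0" if "y \<in> D" for y
  proof -
    have "inner y (P (x - Q x)) = inner (P (y - Q y)) x"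
      using lin(3)[of y x] lin(3)[of y "Q x"] lin(10)[of "P y" x]
      by (simp add: inner_diff_left inner_diff_right lin(5) PQ)
    then show ?thesis using zero[OF that] by simp
  qed
  from domain_dense[OF this] show ?thesis
    by (simp add: lin)
qed

text \<open>
  A Cauchy--Schwarz argument for the quadratic form of \<open>T\<close>. It is tested against \<open>w \<in> D\<close> only,
  since \<open>T x\<close> need not lie in \<open>D\<close>.
\<close>

lemma norm_le_if_form_bounded:
  assumes dense: "closure D = UNIV" and P: "ortho_proj P" "commutes_with P D T" and "0 < \<rho>"
    and form: "\<And>x. x \<in> D \<Longrightarrow> P x = x \<Longrightarrow> \<bar>inner (T x) x\<bar> \<le> \<rho> * (norm x)\<^sup>2"
    and x: "x \<in> D" "P x = x"
  shows "norm (T x) \<le> \<rho> * norm x"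
proof -
  note lin = ortho_projD[OF P(1)]
  define u where "u = T x"
  have Pu: "P u = u"
    using commutes_withD(2)[OF P(2) x(1)] x(2) by (simp add: u_def)
  have "inner u w \<le> \<rho> / 2 * ((norm x)\<^sup>2 + (norm w)\<^sup>2)" if w: "w \<in> D" for w
  proof -
    \<comment> \<open>Replacing \<open>w\<close> by its projection keeps the inner product with
      \<open>u\<close> and makes the form bound available for \<open>x + v\<close> and
      \<open>x - v\<close>, which enter by polarisation.\<close>
    define v where "v = P w"
    have v: "v \<in> D" "P v = v"
      using w by (simp_all add: v_def commutes_withD[OF P(2)] lin)
    have "inner u w = inner u v"
      using Pu lin(3)[of u w] by (simp add: v_def)
    also have "4 * inner u v = inner (T (x + v)) (x + v) - inner (T (x - v)) (x - v)"
      using symmetric[OF x(1) v(1)]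
      by (simp add: u_def domain_add domain_diff x v inner_add_left inner_add_right
          inner_diff_left inner_diff_right inner_commute)
    also have "\<dots> \<le> \<rho> * (norm (x + v))\<^sup>2 + \<rho> * (norm (x - v))\<^sup>2"
      using form[of "x + v"] form[of "x - v"] x v by (simp add: lin domain_add domain_diff abs_le_iff)
    also have "\<dots> = \<rho> * (2 * (norm x)\<^sup>2 + 2 * (norm v)\<^sup>2)"
      by (simp only: parallelogram_law flip: distrib_left)
    also have "\<dots> \<le> \<rho> * (2 * (norm x)\<^sup>2 + 2 * (norm w)\<^sup>2)"
      using \<open>0 < \<rho>\<close> ortho_proj_norm_le[OF P(1), of w]
      by (intro mult_left_mono add_left_mono power_mono) (auto simp: v_def)
    finally show ?thesis by (simp add: algebra_simps)
  qed
  then have "D \<subseteq> {w. inner u w \<le> \<rho> / 2 * ((norm x)\<^sup>2 + (norm w)\<^sup>2)}"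
    by blast
  moreover have "closed {w. inner u w \<le> \<rho> / 2 * ((norm x)\<^sup>2 + (norm w)\<^sup>2)}"
    by (intro closed_Collect_le continuous_intros)
  ultimately have "closure D \<subseteq> {w. inner u w \<le> \<rho> / 2 * ((norm x)\<^sup>2 + (norm w)\<^sup>2)}"
    by (rule closure_minimal)
  \<comment> \<open>By density the bound holds for every \<open>w\<close>. This choice lets half of
    the left side absorb the term in \<open>u\<close> on the right.\<close>
  then have "inner u (u /\<^sub>R \<rho>) \<le> \<rho> / 2 * ((norm x)\<^sup>2 + (norm (u /\<^sub>R \<rho>))\<^sup>2)"
    using dense by blast
  then have "(norm u)\<^sup>2 \<le> (\<rho> * norm x)\<^sup>2"
    using \<open>0 < \<rho>\<close> by (simp add: field_simps power2_eq_square flip: power2_norm_eq_inner)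
  then show ?thesis
    using \<open>0 < \<rho>\<close> unfolding u_def by (simp add: power2_le_iff_abs_le)
qed

section \<open>The family of spectral projections and its form bounds\<close>

definition E :: "real \<Rightarrow> 'a \<Rightarrow> 'a" where
  "E c = nonpositive_proj D (\<lambda>x. T x - c *\<^sub>R x)"

lemma ortho_proj_E: "ortho_proj (E c)"
  unfolding E_def by (rule real_self_adjoint.ortho_proj_N[OF shift])

lemma E_commutes: "commutes_with (E c) D T"
  using real_self_adjoint.N_commutes[OF shift, of c, folded E_def]
  by (simp add: commutes_with_shift ortho_projD(1)[OF ortho_proj_E])

lemma E_form_le: "x \<in> D \<Longrightarrow> E c x = x \<Longrightarrow> inner (T x) x \<le> c * (norm x)\<^sup>2"
  using real_self_adjoint.N_nonpositive[OF shift, of x c, folded E_def]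
  by (simp add: inner_diff_left power2_norm_eq_inner)

lemma E_form_ge: "x \<in> D \<Longrightarrow> E c x = 0 \<Longrightarrow> c * (norm x)\<^sup>2 \<le> inner (T x) x"
  using real_self_adjoint.N_nonnegative[OF shift, of x c, folded E_def]
  by (simp add: inner_diff_left power2_norm_eq_inner)

lemma commute_E:
  assumes "bounded_linear K" "bounded_linear K'"
    and "\<And>x y. inner (K x) y = inner x (K' y)"
    and "commutes_with K D T" "commutes_with K' D T"
  shows "E c (K x) = K (E c x)"
  unfolding E_def using assms
  by (intro real_self_adjoint.commute_N[OF shift, where K' = K'])
    (simp_all add: commutes_with_shift bounded_linear.linear)

lemma commute_E_ortho_proj:
  assumes "ortho_proj P" "commutes_with P D T"
  shows "E c (P x) = P (E c x)"
  using assms by (intro commute_E[where K' = P]) (auto simp: ortho_proj_bounded_linear ortho_projD)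

text \<open>For \<open>c < d\<close> the form bounds on the range of \<open>E c\<close> and the
  kernel of \<open>E d\<close> are incompatible, so \<open>proj_comparison\<close> applies. Equal
  levels give idempotence.\<close>

lemma E_absorb:
  assumes "c \<le> d"
  shows "E c (E d x) = E c x" "E d (E c x) = E c x"
proof -
  have *: "E c (E d y) = E c y" for y
  proof (cases "c = d")
    case False
    show ?thesis
    proof (rule proj_comparison[OF ortho_proj_E E_commutes ortho_proj_E E_commutes _ E_form_le E_form_ge])
      show "E c (E d z) = E d (E c z)" for z
        by (rule commute_E_ortho_proj[OF ortho_proj_E E_commutes])
      show "c < d" using False assms by simp
    qed
  qed (simp add: ortho_projD[OF ortho_proj_E])
  show "E c (E d x) = E c x" by (rule *)
  show "E d (E c x) = E c x" by (rule ortho_proj_absorb_sym[OF ortho_proj_E ortho_proj_E *])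
qed

text \<open>The form bound on the range of \<open>E c\<close> and Cauchy-Schwarz give decay at an
  explicit rate on \<open>D\<close>.\<close>

lemma E_norm_le:
  assumes "x \<in> D" "c < 0"
  shows "norm (E c x) \<le> norm (T x) / - c"
proof -
  let ?v = "E c x"
  have v: "?v \<in> D" "T ?v = E c (T x)"
    using commutes_withD[OF E_commutes assms(1)] by simp_all
  have "inner (T ?v) ?v \<le> c * (norm ?v)\<^sup>2"
    by (rule E_form_le) (simp_all add: v(1) ortho_projD(2)[OF ortho_proj_E])
  then have "- c * (norm ?v)\<^sup>2 \<le> \<bar>inner (T ?v) ?v\<bar>"
    by simp
  also have "\<dots> \<le> norm (T ?v) * norm ?v"
    by (rule Cauchy_Schwarz_ineq2)
  also have "\<dots> \<le> norm (T x) * norm ?v"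
    unfolding v(2) by (intro mult_right_mono ortho_proj_norm_le ortho_proj_E) auto
  finally have "- c * norm ?v \<le> norm (T x)"
    by (rule cancel_norm_le) simp
  then show ?thesis
    using assms(2) by (simp add: field_simps)
qed

lemma E_complement_norm_le:
  assumes "x \<in> D" "0 < c"
  shows "norm (x - E c x) \<le> norm (T x) / c"
proof -
  let ?v = "x - E c x"
  have v: "?v \<in> D" "T ?v = T x - E c (T x)"
    using commutes_withD[OF E_commutes assms(1)] assms(1) by (simp_all add: domain_diff)
  have "c * (norm ?v)\<^sup>2 \<le> inner (T ?v) ?v"
    by (rule E_form_ge) (simp_all add: v(1) ortho_projD[OF ortho_proj_E])
  also have "\<dots> = inner (T x) ?v"
    unfolding v(2) by (simp add: inner_diff_left ortho_projD[OF ortho_proj_E])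
  also have "\<dots> \<le> norm (T x) * norm ?v"
    by (rule norm_cauchy_schwarz)
  finally have "c * norm ?v \<le> norm (T x)"
    by (rule cancel_norm_le) simp
  then show ?thesis
    using assms(2) by (simp add: field_simps)
qed

text \<open>The limits hold on \<open>D\<close> by the explicit rates and extend to all vectors
  because the projections are uniformly contractive.\<close>

lemma E_tendsto:
  assumes dense: "closure D = UNIV"
  shows "((\<lambda>c. E c x) \<longlongrightarrow> 0) at_bot" "((\<lambda>c. E c x) \<longlongrightarrow> x) at_top"
proof -
  have approx: "\<exists>y\<in>D. dist y x < e" if "0 < e" for e
    using dense that closure_approachable[of x D] by auto
  show "((\<lambda>c. E c x) \<longlongrightarrow> 0) at_bot"
  proof (rule tendstoI)
    fix e :: real assume "0 < e"
    then obtain y where y: "y \<in> D" "dist y x < e / 2"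
      using approx[of "e / 2"] by auto
    have "((\<lambda>c. norm (T y) / - c) \<longlongrightarrow> 0) at_bot"
      by (intro tendsto_divide_0[OF tendsto_const] filterlim_at_top_imp_at_infinity
          filterlim_uminus_at_top_at_bot)
    then have "\<forall>\<^sub>F c in at_bot. norm (T y) / - c < e / 2"
      using \<open>0 < e\<close> by (intro order_tendstoD) auto
    then show "\<forall>\<^sub>F c in at_bot. dist (E c x) 0 < e"
      using eventually_gt_at_bot[of "0::real"]
    proof eventually_elim
      case (elim c)
      have "norm (E c x) \<le> norm (E c y) + norm (E c (x - y))"
        using norm_triangle_ineq[of "E c y" "E c (x - y)"] by (simp add: ortho_projD(5)[OF ortho_proj_E])
      moreover have "norm (E c (x - y)) < e / 2"
        using ortho_proj_norm_le[OF ortho_proj_E, of c "x - y"] y(2)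
        by (simp add: dist_norm norm_minus_commute)
      ultimately have "norm (E c x) < e"
        using E_norm_le[OF y(1) elim(2)] elim(1) by linarith
      then show ?case by simp
    qed
  qed
  show "((\<lambda>c. E c x) \<longlongrightarrow> x) at_top"
  proof (rule tendstoI)
    fix e :: real assume "0 < e"
    then obtain y where y: "y \<in> D" "dist y x < e / 3"
      using approx[of "e / 3"] by auto
    have "((\<lambda>c. norm (T y) / c) \<longlongrightarrow> 0) at_top"
      by (intro tendsto_divide_0[OF tendsto_const] filterlim_at_top_imp_at_infinity filterlim_ident)
    then have "\<forall>\<^sub>F c in at_top. norm (T y) / c < e / 3"
      using \<open>0 < e\<close> by (intro order_tendstoD) auto
    then show "\<forall>\<^sub>F c in at_top. dist (E c x) x < e"
      using eventually_gt_at_top[of "0::real"]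
    proof eventually_elim
      case (elim c)
      have "norm (E c x - x) \<le> norm (E c (x - y)) + norm (E c y - y) + norm (y - x)"
        using norm_triangle_ineq[of "E c (x - y)" "(E c y - y) + (y - x)"]
          norm_triangle_ineq[of "E c y - y" "y - x"]
        by (simp add: ortho_projD(5)[OF ortho_proj_E])
      moreover have "norm (E c (x - y)) < e / 3"
        using ortho_proj_norm_le[OF ortho_proj_E, of c "x - y"] y(2)
        by (simp add: dist_norm norm_minus_commute)
      moreover have "norm (E c y - y) < e / 3"
        using E_complement_norm_le[OF y(1) elim(2)] elim(1) norm_minus_commute[of "E c y" y] by linarith
      ultimately show ?case
        using y(2) unfolding dist_norm by linarith
    qed
  qed
qed

text \<open>On the range of \<open>E d - E c\<close> the form of \<open>T\<close> lies between
  \<open>c\<close> and \<open>d\<close>, so that of \<open>T - d\<close> is at most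
  \<open>d - c\<close> in absolute value. The shift is by \<open>d\<close> because the spectral sums
  weight each block with its right endpoint.\<close>

lemma E_block_norm_le:
  assumes dense: "closure D = UNIV" and "c < d" and x: "x \<in> D"
  defines "v \<equiv> E d x - E c x"
  shows "norm (T v - d *\<^sub>R v) \<le> (d - c) * norm v"
proof -
  let ?P = "\<lambda>x. E d x - E c x"
  note lin = ortho_projD[OF ortho_proj_E]
  have P: "ortho_proj ?P"
    using \<open>c < d\<close> by (intro ortho_proj_diff ortho_proj_E E_absorb) auto
  have PT: "commutes_with ?P D T"
    using E_commutes by (simp add: commutes_with_def domain_diff lin)
  show ?thesis
  proof (rule real_self_adjoint.norm_le_if_form_bounded[OF shift dense P])
    show "commutes_with ?P D (\<lambda>x. T x - d *\<^sub>R x)"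
      using PT P by (simp add: commutes_with_shift ortho_projD)
    show "v \<in> D" "?P v = v"
      using x commutes_withD(1)[OF PT] ortho_projD(2)[OF P] by (simp_all add: v_def)
    fix y assume y: "y \<in> D" "?P y = y"
    have "E d y = y"
      using y(2) E_absorb(2)[of c d y] \<open>c < d\<close> lin(2)[of d y] lin(5)[of d "E d y" "E c y"] by simp
    moreover from this have "E c y = 0"
      using y(2) by simp
    ultimately show "\<bar>inner (T y - d *\<^sub>R y) y\<bar> \<le> (d - c) * (norm y)\<^sup>2"
      using E_form_le[OF y(1), of d] E_form_ge[OF y(1), of c]
      by (simp add: inner_diff_left power2_norm_eq_inner algebra_simps)
  qed (use \<open>c < d\<close> in simp)
qed

end

section \<open>Complex Hilbert spaces\<close>

text \<open>Conjugate linearity in the second argument turns the imaginary part into a real part, so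
  real results determine the complex inner product.\<close>

lemma cinner_eq: "cinner x y = Complex (inner x y) (inner x (\<i> *\<^sub>C y))"
proof -
  have "cinner x (\<i> *\<^sub>C y) = - \<i> * cinner x y"
    by (metis cinner_commute cinner_scaleC_left complex_cnj_i complex_cnj_mult)
  then show ?thesis
    by (simp add: inner_eq_Re_cinner complex_eq_iff)
qed

lemma inner_i_left: "inner (\<i> *\<^sub>C x) y = - inner x (\<i> *\<^sub>C y)"
  using arg_cong[OF cinner_eq[of x y], of Im] by (simp add: inner_eq_Re_cinner cinner_scaleC_left)

lemma scaleC_eq: "c *\<^sub>C x = Re c *\<^sub>R x + Im c *\<^sub>R (\<i> *\<^sub>C x)"
proof -
  have "c = complex_of_real (Re c) + complex_of_real (Im c) * \<i>"
    by (simp add: complex_eq_iff)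
  then show ?thesis
    by (metis scaleC_add_left scaleC_of_real scaleC_scaleC)
qed

lemma bounded_linear_i: "bounded_linear (\<lambda>x::'a::complex_hilbert_space. \<i> *\<^sub>C x)"
proof (rule bounded_linear_intro[where K = 1])
  fix x y :: 'a and r :: real
  show "\<i> *\<^sub>C (x + y) = \<i> *\<^sub>C x + \<i> *\<^sub>C y"
    by (rule scaleC_add_right)
  show "\<i> *\<^sub>C (r *\<^sub>R x) = r *\<^sub>R (\<i> *\<^sub>C x)"
    by (simp add: scaleC_scaleC mult.commute flip: scaleC_of_real)
  have "inner (\<i> *\<^sub>C x) (\<i> *\<^sub>C x) = inner x x"
    using scaleC_of_real[of "-1" x] by (simp add: inner_i_left scaleC_scaleC)
  then show "norm (\<i> *\<^sub>C x) \<le> norm x * 1"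
    by (simp add: norm_eq_sqrt_inner)
qed

lemma orthogonal_projection_ortho_proj:
  assumes "orthogonal_projection P"
  shows "ortho_proj P"
  using assms unfolding orthogonal_projection_def ortho_proj_def
  by (simp add: bounded_linear.linear inner_eq_Re_cinner)

lemma orthogonal_projectionI:
  assumes P: "ortho_proj P" and i: "\<And>x. P (\<i> *\<^sub>C x) = \<i> *\<^sub>C P x"
  shows "orthogonal_projection P"
  unfolding orthogonal_projection_def clinear_on_def
proof (intro conjI ballI allI)
  fix c x y
  show "P (c *\<^sub>C x) = c *\<^sub>C P x"
    by (simp add: scaleC_eq[of c] ortho_projD[OF P] i)
  show "cinner (P x) y = cinner x (P y)"
    by (simp add: cinner_eq ortho_projD(3)[OF P] i)
qed (use P in \<open>simp_all add: ortho_projD ortho_proj_bounded_linear\<close>)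

text \<open>The difference is a projection, which makes the real part of its form a squared norm.
  The imaginary part vanishes since the difference commutes with \<open>\<i>\<close>, which is skew
  for the real inner product.\<close>

lemma operator_leI:
  assumes P: "ortho_proj P" and i: "\<And>x. P (\<i> *\<^sub>C x) = \<i> *\<^sub>C P x"
    and Q: "ortho_proj Q" and j: "\<And>x. Q (\<i> *\<^sub>C x) = \<i> *\<^sub>C Q x"
    and PQ: "\<And>x. P (Q x) = P x" "\<And>x. Q (P x) = P x"
  shows "operator_le P Q"
  unfolding operator_le_def
proof
  fix x
  define R where "R x = Q x - P x" for x
  have R: "ortho_proj R"
    unfolding R_def by (rule ortho_proj_diff[OF P Q PQ])
  have "inner (R x) (\<i> *\<^sub>C x) = inner (R x) (\<i> *\<^sub>C R x)"
  proof -
    have "R (\<i> *\<^sub>C x) = \<i> *\<^sub>C R x"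
      by (simp add: R_def i j linear_diff[OF bounded_linear.linear[OF bounded_linear_i]])
    then show ?thesis
      by (metis ortho_projD(2,3)[OF R])
  qed
  moreover have "inner (R x) (\<i> *\<^sub>C R x) = 0"
    using inner_i_left[of "R x" "R x"] by (simp add: inner_commute)
  ultimately have "cinner (R x) x = complex_of_real ((norm (R x))\<^sup>2)"
    by (simp add: cinner_eq ortho_proj_inner[OF R] complex_eq_iff)
  then show "cinner (Q x - P x) x \<in> \<real>\<^sub>\<ge>\<^sub>0"
    by (simp add: R_def)
qed

lemma self_adjoint_operator_dense: "self_adjoint_operator D T \<Longrightarrow> closure D = UNIV"
  by (simp add: self_adjoint_operator_def densely_defined_operator_def)

lemma self_adjoint_operator_i:
  assumes "self_adjoint_operator D T"
  shows "commutes_with (\<lambda>x. \<i> *\<^sub>C x) D T"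
  using assms
  by (simp add: self_adjoint_operator_def densely_defined_operator_def csubspace_def clinear_on_def
      commutes_with_def)

lemma self_adjoint_operator_real:
  assumes sa: "self_adjoint_operator D T"
  shows "real_self_adjoint D T"
proof
  fix y z
  have i: "\<i> *\<^sub>C x \<in> D" "T (\<i> *\<^sub>C x) = \<i> *\<^sub>C T x" if "x \<in> D" for x
    using commutes_withD[OF self_adjoint_operator_i[OF sa] that] .
  \<comment> \<open>Testing the real identity at \<open>\<i> *\<^sub>C x\<close> supplies the
    imaginary part of the complex one.\<close>
  have iff: "(\<forall>x\<in>D. cinner (T x) y = cinner x z) \<longleftrightarrow> (\<forall>x\<in>D. inner (T x) y = inner x z)" for y z
  proof
    assume *: "\<forall>x\<in>D. inner (T x) y = inner x z"
    show "\<forall>x\<in>D. cinner (T x) y = cinner x z"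
    proof
      fix x assume x: "x \<in> D"
      have "inner (\<i> *\<^sub>C T x) y = inner (\<i> *\<^sub>C x) z"
        using * i[OF x] by metis
      then show "cinner (T x) y = cinner x z"
        using * x by (simp add: cinner_eq inner_i_left)
    qed
  qed (simp add: inner_eq_Re_cinner)
  have unique: "z = z'" if "\<forall>x\<in>D. inner (T x) y = inner x z" "\<forall>x\<in>D. inner (T x) y = inner x z'" for y z z'
  proof -
    have "D \<subseteq> {x. inner x (z - z') = 0}"
      using that by (auto simp: inner_diff_right)
    moreover have "closed {x. inner x (z - z') = 0}"
      by (intro closed_Collect_eq continuous_intros)
    ultimately have "closure D \<subseteq> {x. inner x (z - z') = 0}"
      by (rule closure_minimal)
    then have "inner (z - z') (z - z') = 0"
      using self_adjoint_operator_dense[OF sa] by blast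
    then show ?thesis by simp
  qed
  have dom: "y \<in> D \<longleftrightarrow> (\<exists>z. \<forall>x\<in>D. inner (T x) y = inner x z)" for y
    using sa unfolding self_adjoint_operator_def adjoint_domain_def iff by blast
  have "\<forall>x\<in>D. inner (T x) y = inner x (T y)" if y: "y \<in> D" for y
  proof -
    have "\<exists>!z. \<forall>x\<in>D. inner (T x) y = inner x z"
      using y dom unique by blast
    from theI'[OF this] have "\<forall>x\<in>D. inner (T x) y = inner x (adjoint_operator D T y)"
      by (simp add: adjoint_operator_def iff)
    moreover have "adjoint_operator D T y = T y"
      using sa y by (simp add: self_adjoint_operator_def)
    ultimately show ?thesis by simp
  qed
  then show "(\<forall>x\<in>D. inner (T x) y = inner x z) \<longleftrightarrow> y \<in> D \<and> T y = z"
    using dom unique by blast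
qed

section \<open>Partitions and spectral sums\<close>

lemma partition_mono:
  assumes "is_partition a b n s" "i \<le> j" "j \<le> n"
  shows "s i \<le> s j"
  using assms(2,3)
proof (induction j rule: dec_induct)
  case (step m)
  then have "Suc m \<in> {1..n}" by simp
  with assms(1) have "s (Suc m - 1) < s (Suc m)"
    unfolding is_partition_def by blast
  with step show ?case by simp
qed simp

lemma partition_telescope:
  fixes f :: "real \<Rightarrow> 'b::ab_group_add"
  assumes "is_partition a b n s"
  shows "(\<Sum>k=1..n. f (s k) - f (s (k - 1))) = f b - f a"
  using assms sum_telescope''[of 0 n "\<lambda>k. f (s k)"] by (auto simp: is_partition_def)

lemma partition_exists:
  assumes "a < b" "0 < e"
  shows "\<exists>n s. is_partition a b n s \<and> (\<forall>k\<in>{1..n}. s k - s (k - 1) < e)"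
proof -
  obtain n :: nat where n: "(b - a) / e < n"
    using reals_Archimedean2 by blast
  then have "0 < n"
    using assms by (metis divide_pos_pos diff_gt_0_iff_gt of_nat_0_less_iff order.strict_trans)
  define s where "s k = a + k * ((b - a) / n)" for k :: nat
  have step: "s k - s (k - 1) = (b - a) / n" if "k \<in> {1..n}" for k
  proof -
    have "real k - real (k - 1) = 1"
      using that by (simp add: of_nat_diff)
    moreover have "s k - s (k - 1) = (real k - real (k - 1)) * ((b - a) / n)"
      by (simp only: s_def left_diff_distrib add_diff_cancel_left)
    ultimately show ?thesis by simp
  qed
  have "0 < (b - a) / n" "(b - a) / n < e"
    using assms n \<open>0 < n\<close> by (simp_all add: field_simps)
  then have "s (k - 1) < s k" "s k - s (k - 1) < e" if "k \<in> {1..n}" for k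
    using step[OF that] by linarith+
  moreover have "s 0 = a" "s n = b"
    using \<open>0 < n\<close> by (simp_all add: s_def)
  ultimately have "is_partition a b n s \<and> (\<forall>k\<in>{1..n}. s k - s (k - 1) < e)"
    using \<open>0 < n\<close> unfolding is_partition_def by auto
  then show ?thesis by blast
qed

text \<open>One partition serves both vectors, so that the symmetry of the spectral sums can later
  be carried to the limit. The single parameter \<open>e\<close> controls mesh, endpoints and both
  errors.\<close>

lemma spectral_integral_approx:
  assumes x: "has_spectral_integral E x p" and y: "has_spectral_integral E y q" and "0 < e"
  shows "\<exists>a b n s. is_partition a b n s \<and> (\<forall>k\<in>{1..n}. s k - s (k - 1) < e) \<and>
    a < - 1 / e \<and> 1 / e < b \<and>
    dist (spectral_sum E x n s) p < e \<and> dist (spectral_sum E y n s) q < e"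
proof -
  obtain J where J: "\<And>a b. a < b \<Longrightarrow> has_spectral_integral_on E x a b (J a b)"
      "((\<lambda>(a, b). J a b) \<longlongrightarrow> p) (at_bot \<times>\<^sub>F at_top)"
    using x by (auto simp: has_spectral_integral_def)
  obtain K where K: "\<And>a b. a < b \<Longrightarrow> has_spectral_integral_on E y a b (K a b)"
      "((\<lambda>(a, b). K a b) \<longlongrightarrow> q) (at_bot \<times>\<^sub>F at_top)"
    using y by (auto simp: has_spectral_integral_def)
  have "0 < e / 2" using \<open>0 < e\<close> by simp
  have "\<forall>\<^sub>F ab in at_bot \<times>\<^sub>F at_top. fst ab < - 1 / e \<and> 1 / e < snd ab"
    by (intro eventually_prodI eventually_gt_at_bot eventually_gt_at_top)
  with tendstoD[OF J(2) \<open>0 < e / 2\<close>] tendstoD[OF K(2) \<open>0 < e / 2\<close>]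
  have "\<forall>\<^sub>F ab in at_bot \<times>\<^sub>F at_top. dist (case ab of (a, b) \<Rightarrow> J a b) p < e / 2 \<and>
      dist (case ab of (a, b) \<Rightarrow> K a b) q < e / 2 \<and> fst ab < - 1 / e \<and> 1 / e < snd ab"
    by eventually_elim auto
  moreover have "at_bot \<times>\<^sub>F at_top \<noteq> (bot :: (real \<times> real) filter)"
    by (simp add: prod_filter_eq_bot)
  ultimately obtain a b :: real where ab: "dist (J a b) p < e / 2" "dist (K a b) q < e / 2"
      "a < - 1 / e" "1 / e < b"
    using eventually_happens by fastforce
  have "- 1 / e < 1 / e"
    using \<open>0 < e\<close> by (simp add: divide_strict_right_mono)
  with ab have "a < b" by linarith
  obtain d where d: "0 < d" "\<And>n s. is_partition a b n s \<Longrightarrow> (\<forall>k\<in>{1..n}. s k - s (k - 1) < d) \<Longrightarrow>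
      norm (spectral_sum E x n s - J a b) < e / 2"
    using J(1)[OF \<open>a < b\<close>] \<open>0 < e / 2\<close> unfolding has_spectral_integral_on_def by metis
  obtain d' where d': "0 < d'" "\<And>n s. is_partition a b n s \<Longrightarrow> (\<forall>k\<in>{1..n}. s k - s (k - 1) < d') \<Longrightarrow>
      norm (spectral_sum E y n s - K a b) < e / 2"
    using K(1)[OF \<open>a < b\<close>] \<open>0 < e / 2\<close> unfolding has_spectral_integral_on_def by metis
  obtain n s where s: "is_partition a b n s" "\<And>k. k \<in> {1..n} \<Longrightarrow> s k - s (k - 1) < min e (min d d')"
    using partition_exists[OF \<open>a < b\<close>, of "min e (min d d')"] \<open>0 < e\<close> d(1) d'(1) by auto
  have "\<forall>k\<in>{1..n}. s k - s (k - 1) < d" "\<forall>k\<in>{1..n}. s k - s (k - 1) < d'"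
      "\<forall>k\<in>{1..n}. s k - s (k - 1) < e"
    using s(2) by (metis min_less_iff_conj)+
  moreover have "dist (spectral_sum E x n s) p < e"
  proof (rule dist_triangle_half_l[OF _ ab(1)[unfolded dist_commute[of "J a b"]]])
    show "dist (spectral_sum E x n s) (J a b) < e / 2"
      using d(2)[OF s(1)] calculation(1) by (simp add: dist_norm)
  qed
  moreover have "dist (spectral_sum E y n s) q < e"
  proof (rule dist_triangle_half_l[OF _ ab(2)[unfolded dist_commute[of "K a b"]]])
    show "dist (spectral_sum E y n s) (K a b) < e / 2"
      using d'(2)[OF s(1)] calculation(2) by (simp add: dist_norm)
  qed
  ultimately show ?thesis
    using s(1) ab(3,4) by blast
qed

lemma spectral_integral_sequence:
  assumes "has_spectral_integral E x p" "has_spectral_integral E y q"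
  obtains a b n s where "\<And>m. is_partition (a m) (b m) (n m) (s m)"
    "\<And>m k. k \<in> {1..n m} \<Longrightarrow> s m k - s m (k - 1) < 1 / Suc m"
    "filterlim a at_bot sequentially" "filterlim b at_top sequentially"
    "(\<lambda>m. spectral_sum E x (n m) (s m)) \<longlonglongrightarrow> p" "(\<lambda>m. spectral_sum E y (n m) (s m)) \<longlonglongrightarrow> q"
proof -
  have "\<forall>m. \<exists>a b n s. is_partition a b n s \<and> (\<forall>k\<in>{1..n}. s k - s (k - 1) < 1 / Suc m) \<and>
    a < - 1 / (1 / Suc m) \<and> 1 / (1 / Suc m) < b \<and>
    dist (spectral_sum E x n s) p < 1 / Suc m \<and> dist (spectral_sum E y n s) q < 1 / Suc m"
    by (intro allI spectral_integral_approx assms) simp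
  then obtain a b n s where *: "\<And>m. is_partition (a m) (b m) (n m) (s m)"
    "\<And>m k. k \<in> {1..n m} \<Longrightarrow> s m k - s m (k - 1) < 1 / Suc m"
    "\<And>m. a m < - 1 / (1 / Suc m)" "\<And>m. 1 / (1 / Suc m) < b m"
    "\<And>m. dist (spectral_sum E x (n m) (s m)) p < 1 / Suc m"
    "\<And>m. dist (spectral_sum E y (n m) (s m)) q < 1 / Suc m"
    by metis
  have lim: "(\<lambda>m. 1 / real (Suc m)) \<longlonglongrightarrow> 0"
    using LIMSEQ_Suc[OF lim_1_over_n] by simp
  have top: "filterlim (\<lambda>m. real (Suc m)) at_top sequentially"
    by (rule filterlim_compose[OF filterlim_real_sequentially filterlim_Suc])
  show thesis
  proof (rule that[of a b n s])
    show "filterlim b at_top sequentially"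
      by (rule filterlim_at_top_mono[OF top]) (use *(4) in \<open>auto intro!: always_eventually less_imp_le\<close>)
    have "filterlim (\<lambda>m. - a m) at_top sequentially"
    proof (rule filterlim_at_top_mono[OF top], intro always_eventually allI)
      show "real (Suc m) \<le> - a m" for m
        using *(3)[of m] by simp
    qed
    then show "filterlim a at_bot sequentially"
      by (simp add: filterlim_uminus_at_top)
    show "(\<lambda>m. spectral_sum E x (n m) (s m)) \<longlonglongrightarrow> p"
      by (rule metric_tendsto_imp_tendsto[OF lim]) (use *(5) in \<open>auto intro!: always_eventually less_imp_le\<close>)
    show "(\<lambda>m. spectral_sum E y (n m) (s m)) \<longlonglongrightarrow> q"
      by (rule metric_tendsto_imp_tendsto[OF lim]) (use *(6) in \<open>auto intro!: always_eventually less_imp_le\<close>)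
  qed (use * in auto)
qed

section \<open>Existence\<close>

context
  fixes D :: "'a::complex_hilbert_space set" and T :: "'a \<Rightarrow> 'a"
  assumes sa: "self_adjoint_operator D T"
begin

interpretation real_self_adjoint D T
  using sa by (rule self_adjoint_operator_real)

text \<open>Multiplication by \<open>\<i>\<close> commutes with \<open>T\<close>, and so does its
  real adjoint, multiplication by \<open>- \<i>\<close>.\<close>

lemma E_i: "E c (\<i> *\<^sub>C x) = \<i> *\<^sub>C E c x"
proof (rule commute_E[OF bounded_linear_i bounded_linear_minus[OF bounded_linear_i]])
  show "inner (\<i> *\<^sub>C x) y = inner x (- (\<i> *\<^sub>C y))" for x y :: 'a
    by (simp add: inner_i_left)
  show i: "commutes_with (\<lambda>x. \<i> *\<^sub>C x) D T"
    by (rule self_adjoint_operator_i[OF sa])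
  show "commutes_with (\<lambda>x. - (\<i> *\<^sub>C x)) D T"
    using i domain_scaleR[of _ "-1"] by (auto simp: commutes_with_def)
qed

lemma spectral_family_E: "spectral_family E"
  unfolding spectral_family_def
proof (intro conjI allI impI)
  show "operator_le (E \<mu>) (E \<nu>)" if "\<mu> \<le> \<nu>" for \<mu> \<nu>
    by (intro operator_leI ortho_proj_E E_i E_absorb that)
qed (intro orthogonal_projectionI ortho_proj_E E_i E_tendsto self_adjoint_operator_dense[OF sa])+

text \<open>The errors on different blocks are mutually orthogonal and each is at most the mesh
  bound times the norm of the block of \<open>x\<close>. By Pythagoras the total error is at most
  the mesh bound times \<open>norm x\<close>.\<close>

lemma E_integral_on:
  assumes x: "x \<in> D"
  shows "has_spectral_integral_on E x a b (E b (T x) - E a (T x))"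
  unfolding has_spectral_integral_on_def
proof (intro allI impI)
  fix e :: real assume "0 < e"
  \<comment> \<open>The final error is at most \<open>d * norm x\<close>; the added 1 covers
    \<open>x = 0\<close>.\<close>
  define d where "d = e / (norm x + 1)"
  have "0 < d" "d * norm x < e"
    using \<open>0 < e\<close> by (simp_all add: d_def field_simps add_pos_nonneg pos_add_strict)
  show "\<exists>d>0. \<forall>n s. is_partition a b n s \<and> (\<forall>k\<in>{1..n}. s k - s (k - 1) < d) \<longrightarrow>
      norm (spectral_sum E x n s - (E b (T x) - E a (T x))) < e"
  proof (intro exI[of _ d] conjI allI impI \<open>0 < d\<close>)
    fix n s
    assume "is_partition a b n s \<and> (\<forall>k\<in>{1..n}. s k - s (k - 1) < d)"
    then have s: "is_partition a b n s" and mesh: "\<And>k. k \<in> {1..n} \<Longrightarrow> s k - s (k - 1) < d"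
      by auto
    define P where "P k y = E (s k) y - E (s (k - 1)) y" for k y
    define u where "u k = s k *\<^sub>R P k x - T (P k x)" for k
    have less: "s (k - 1) < s k" if "k \<in> {1..n}" for k
      using s that by (auto simp: is_partition_def)
    have P: "ortho_proj (P k)" if "k \<in> {1..n}" for k
      unfolding P_def using less[OF that] by (intro ortho_proj_diff ortho_proj_E E_absorb) auto
    have TP: "P k x \<in> D" "T (P k x) = P k (T x)" for k
      using x by (simp_all add: P_def domain_diff commutes_withD[OF E_commutes])
    have PP: "P i (P j y) = 0" if "i \<in> {1..n}" "j \<in> {1..n}" "i < j" for i j y
    proof -
      have "s i \<le> s (j - 1)"
        using that by (intro partition_mono[OF s]) auto
      moreover have "s (i - 1) < s i" "s (j - 1) < s j"
        using less that by auto
      ultimately show ?thesis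
        by (simp add: P_def ortho_projD[OF ortho_proj_E] E_absorb)
    qed
    have Pu: "u k = P k (s k *\<^sub>R x - T x)" for k
      by (simp add: u_def TP) (simp add: P_def ortho_projD[OF ortho_proj_E] algebra_simps)
    have "inner (u i) (u j) = 0" if "i \<in> {1..n}" "j \<in> {1..n}" "i < j" for i j
      using PP[OF that] by (simp add: Pu ortho_projD(3)[OF P[OF that(1)]])
    then have orth: "pairwise (\<lambda>i j. orthogonal (u i) (u j)) {1..n}"
      unfolding pairwise_def orthogonal_def by (metis inner_commute linorder_neqE_nat)
    have u_le: "norm (u k) \<le> d * norm (P k x)" if "k \<in> {1..n}" for k
    proof -
      have "norm (u k) \<le> (s k - s (k - 1)) * norm (P k x)"
        unfolding u_def P_def
        using E_block_norm_le[OF self_adjoint_operator_dense[OF sa] less[OF that] x] by (simp add: norm_minus_commute)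
      also have "\<dots> \<le> d * norm (P k x)"
        using mesh[OF that] by (intro mult_right_mono) auto
      finally show ?thesis .
    qed
    have "spectral_sum E x n s - (E b (T x) - E a (T x)) = (\<Sum>k=1..n. u k)"
      using partition_telescope[OF s, of "\<lambda>c. E c (T x)"]
      by (simp add: spectral_sum_def u_def TP sum_subtractf) (simp add: P_def sum_subtractf)
    also have "(norm \<dots>)\<^sup>2 = (\<Sum>k=1..n. (norm (u k))\<^sup>2)"
      by (rule norm_sum_Pythagorean[OF _ orth]) simp
    also have "\<dots> \<le> (\<Sum>k=1..n. d\<^sup>2 * (norm (P k x))\<^sup>2)"
      using u_le by (intro sum_mono) (simp add: power_mono flip: power_mult_distrib)
    also have "\<dots> = d\<^sup>2 * (\<Sum>k=1..n. inner (P k x) x)"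
      unfolding sum_distrib_left using P by (intro sum.cong) (simp_all add: ortho_proj_inner)
    also have "(\<Sum>k=1..n. inner (P k x) x) = inner (E b x) x - inner (E a x) x"
      using partition_telescope[OF s, of "\<lambda>c. inner (E c x) x"] by (simp add: P_def inner_diff_left)
    also have "d\<^sup>2 * (inner (E b x) x - inner (E a x) x) \<le> d\<^sup>2 * (norm x)\<^sup>2"
    proof (rule mult_left_mono)
      have "inner (E b x) x \<le> (norm x)\<^sup>2"
        using ortho_proj_norm_le[OF ortho_proj_E] by (simp add: ortho_proj_inner[OF ortho_proj_E] power_mono)
      moreover have "0 \<le> inner (E a x) x"
        by (simp add: ortho_proj_inner[OF ortho_proj_E])
      ultimately show "inner (E b x) x - inner (E a x) x \<le> (norm x)\<^sup>2" by linarith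
    qed simp
    finally have "(norm (spectral_sum E x n s - (E b (T x) - E a (T x))))\<^sup>2 \<le> (d * norm x)\<^sup>2"
      by (simp add: power_mult_distrib)
    then have "norm (spectral_sum E x n s - (E b (T x) - E a (T x))) \<le> d * norm x"
      using \<open>0 < d\<close> by (simp add: power2_le_iff_abs_le)
    with \<open>d * norm x < e\<close> show "norm (spectral_sum E x n s - (E b (T x) - E a (T x))) < e"
      by linarith
  qed
qed

lemma represents_operator_E: "represents_operator E D T"
  unfolding represents_operator_def has_spectral_integral_def
proof (intro ballI exI conjI allI impI)
  fix x assume "x \<in> D"
  then show "has_spectral_integral_on E x a b (E b (T x) - E a (T x))" for a b
    by (rule E_integral_on)
  have "((\<lambda>p. E (snd p) (T x) - E (fst p) (T x)) \<longlongrightarrow> T x - 0) (at_bot \<times>\<^sub>F at_top)"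
    by (intro tendsto_diff filterlim_compose[OF E_tendsto(1)[OF self_adjoint_operator_dense[OF sa]] filterlim_fst]
        filterlim_compose[OF E_tendsto(2)[OF self_adjoint_operator_dense[OF sa]] filterlim_snd])
  then show "((\<lambda>(a, b). E b (T x) - E a (T x)) \<longlongrightarrow> T x) (at_bot \<times>\<^sub>F at_top)"
    by (simp add: case_prod_unfold)
qed

end

section \<open>Uniqueness\<close>

context
  fixes F :: "real \<Rightarrow> 'a::complex_hilbert_space \<Rightarrow> 'a"
  assumes F: "spectral_family F"
begin

lemma spectral_family_ortho_proj: "ortho_proj (F c)"
  using F by (simp add: spectral_family_def orthogonal_projection_ortho_proj)

text \<open>The form of a projection is a squared norm, so the operator order forces the kernel of
  \<open>F d\<close> into that of \<open>F c\<close>.\<close>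

lemma spectral_family_absorb:
  assumes "c \<le> d"
  shows "F c (F d x) = F c x" "F d (F c x) = F c x"
proof -
  note lin = ortho_projD[OF spectral_family_ortho_proj]
  have le: "operator_le (F c) (F d)"
    using F assms by (simp add: spectral_family_def)
  have inner_le: "inner (F c y) y \<le> inner (F d y) y" for y
  proof -
    have "0 \<le> inner (F d y - F c y) y"
      using le by (simp add: operator_le_def inner_eq_Re_cinner complex_nonneg_Reals_iff)
    then show ?thesis by (simp add: inner_diff_left)
  qed
  have *: "F c (F d y) = F c y" for y
  proof -
    have "F d (y - F d y) = 0"
      by (simp add: lin)
    then have "F c (y - F d y) = 0"
      using inner_le[of "y - F d y"] by (simp add: ortho_proj_inner[OF spectral_family_ortho_proj])
    then show ?thesis
      by (simp add: lin)
  qed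
  show "F c (F d x) = F c x" by (rule *)
  show "F d (F c x) = F c x"
    by (rule ortho_proj_absorb_sym[OF spectral_family_ortho_proj spectral_family_ortho_proj *])
qed

lemma spectral_family_commute: "F c (F d x) = F d (F c x)"
  using spectral_family_absorb[of c d] spectral_family_absorb[of d c] by (cases "c \<le> d") auto

lemma spectral_sum_symmetric: "inner (spectral_sum F x n s) y = inner x (spectral_sum F y n s)"
  by (simp add: spectral_sum_def inner_sum_left inner_sum_right inner_diff_left inner_diff_right
      ortho_projD(3)[OF spectral_family_ortho_proj])

lemma spectral_sum_commute: "F c (spectral_sum F x n s) = spectral_sum F (F c x) n s"
  unfolding spectral_sum_def linear_sum[OF ortho_projD(1)[OF spectral_family_ortho_proj]]
  by (intro sum.cong refl)
    (simp only: ortho_projD(5,7)[OF spectral_family_ortho_proj] spectral_family_commute[of c])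

lemma spectral_sum_inner:
  "inner (spectral_sum F x n s) x = (\<Sum>k=1..n. s k * (norm (F (s k) x - F (s (k - 1)) x))\<^sup>2)"
  if "is_partition a b n s"
  unfolding spectral_sum_def inner_sum_left
proof (rule sum.cong[OF refl])
  fix k assume "k \<in> {1..n}"
  then have "s (k - 1) < s k"
    using that by (auto simp: is_partition_def)
  then have "ortho_proj (\<lambda>x. F (s k) x - F (s (k - 1)) x)"
    by (intro ortho_proj_diff spectral_family_ortho_proj spectral_family_absorb) auto
  from ortho_proj_inner[OF this]
  show "inner (s k *\<^sub>R (F (s k) x - F (s (k - 1)) x)) x = s k * (norm (F (s k) x - F (s (k - 1)) x))\<^sup>2"
    by simp
qed

lemma block_norm_sum:
  assumes s: "is_partition a b n s"
  shows "(\<Sum>k=1..n. (norm (F (s k) x - F (s (k - 1)) x))\<^sup>2) = inner (F b x) x - inner (F a x) x"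
proof -
  have "(\<Sum>k=1..n. (norm (F (s k) x - F (s (k - 1)) x))\<^sup>2) =
      (\<Sum>k=1..n. inner (F (s k) x) x - inner (F (s (k - 1)) x) x)"
  proof (rule sum.cong[OF refl])
    fix k assume "k \<in> {1..n}"
    then have "s (k - 1) < s k"
      using s by (auto simp: is_partition_def)
    then have "ortho_proj (\<lambda>x. F (s k) x - F (s (k - 1)) x)"
      by (intro ortho_proj_diff spectral_family_ortho_proj spectral_family_absorb) auto
    from ortho_proj_inner[OF this, of x]
    show "(norm (F (s k) x - F (s (k - 1)) x))\<^sup>2 = inner (F (s k) x) x - inner (F (s (k - 1)) x) x"
      by (simp add: inner_diff_left)
  qed
  then show ?thesis
    using partition_telescope[OF s, of "\<lambda>c. inner (F c x) x"] by simp
qed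

section \<open>Spectral families representing a given self-adjoint operator\<close>

context
  fixes D :: "'a set" and T :: "'a \<Rightarrow> 'a"
  assumes sa: "self_adjoint_operator D T" and rep: "represents_operator F D T"
begin

interpretation real_self_adjoint D T
  using sa by (rule self_adjoint_operator_real)

text \<open>Spectral sums are symmetric and commute with \<open>F c\<close>. In the limit
  \<open>F c x\<close> satisfies the adjoint relation with value \<open>F c (T x)\<close>, and
  self-adjointness places it in \<open>D\<close>.\<close>

lemma represents_commutes: "commutes_with (F c) D T"
  unfolding commutes_with_def
proof
  fix x assume x: "x \<in> D"
  have "inner (T y) (F c x) = inner y (F c (T x))" if y: "y \<in> D" for y
  proof -
    obtain a b n s where *: "(\<lambda>m. spectral_sum F x (n m) (s m)) \<longlonglongrightarrow> T x"
        "(\<lambda>m. spectral_sum F y (n m) (s m)) \<longlonglongrightarrow> T y"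
      using spectral_integral_sequence[of F x "T x" y "T y"] rep x y
      unfolding represents_operator_def by metis
    have eq: "inner (spectral_sum F y (n m) (s m)) (F c x) = inner y (F c (spectral_sum F x (n m) (s m)))" for m
      by (simp add: spectral_sum_symmetric spectral_sum_commute)
    have lim: "(\<lambda>m. inner (spectral_sum F y (n m) (s m)) (F c x)) \<longlonglongrightarrow> inner (T y) (F c x)"
      by (intro tendsto_intros *)
    have "(\<lambda>m. inner y (F c (spectral_sum F x (n m) (s m)))) \<longlonglongrightarrow> inner y (F c (T x))"
      by (rule tendsto_inner[OF tendsto_const bounded_linear.tendsto[OF
            ortho_proj_bounded_linear[OF spectral_family_ortho_proj] *(1)]])
    with lim[unfolded eq] show ?thesis
      by (rule LIMSEQ_unique)
  qed
  from adjointI[OF this] show "F c x \<in> D \<and> T (F c x) = F c (T x)" by blast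
qed

lemma represents_sequence:
  assumes x: "x \<in> D"
  obtains a b n s where "\<And>m. is_partition (a m) (b m) (n m) (s m)"
    "\<And>m k. k \<in> {1..n m} \<Longrightarrow> s m k - s m (k - 1) < 1 / Suc m"
    "(\<lambda>m. inner (F (b m) x) x - inner (F (a m) x) x) \<longlonglongrightarrow> (norm x)\<^sup>2"
    "(\<lambda>m. inner (spectral_sum F x (n m) (s m)) x) \<longlonglongrightarrow> inner (T x) x"
proof -
  have int: "has_spectral_integral F x (T x)"
    using rep x by (simp add: represents_operator_def)
  obtain a b n s where *: "\<And>m. is_partition (a m) (b m) (n m) (s m)"
    "\<And>m k. k \<in> {1..n m} \<Longrightarrow> s m k - s m (k - 1) < 1 / Suc m"
    "filterlim a at_bot sequentially" "filterlim b at_top sequentially"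
    "(\<lambda>m. spectral_sum F x (n m) (s m)) \<longlonglongrightarrow> T x"
    "(\<lambda>m. spectral_sum F x (n m) (s m)) \<longlonglongrightarrow> T x"
    by (fact spectral_integral_sequence[OF int int])
  have lims: "((\<lambda>c. F c x) \<longlongrightarrow> 0) at_bot" "((\<lambda>c. F c x) \<longlongrightarrow> x) at_top"
    using F by (simp_all add: spectral_family_def)
  show thesis
  proof (rule that[OF *(1,2)])
    have "(\<lambda>m. inner (F (b m) x) x - inner (F (a m) x) x) \<longlonglongrightarrow> inner x x - inner 0 x"
      by (intro tendsto_intros filterlim_compose[OF lims(1) *(3)] filterlim_compose[OF lims(2) *(4)])
    then show "(\<lambda>m. inner (F (b m) x) x - inner (F (a m) x) x) \<longlonglongrightarrow> (norm x)\<^sup>2"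
      by (simp add: power2_norm_eq_inner)
    show "(\<lambda>m. inner (spectral_sum F x (n m) (s m)) x) \<longlonglongrightarrow> inner (T x) x"
      by (intro tendsto_intros *(5))
  qed
qed

text \<open>Blocks starting at or above \<open>c\<close> contribute nothing, since \<open>F\<close>
  is constant at \<open>x\<close> there. A block straddling \<open>c\<close> has its right endpoint
  within the mesh of \<open>c\<close>, hence the error \<open>1 / Suc m\<close>.\<close>

lemma represents_form_le:
  assumes x: "x \<in> D" and Fx: "F c x = x"
  shows "inner (T x) x \<le> c * (norm x)\<^sup>2"
proof -
  obtain a b n s where *: "\<And>m. is_partition (a m) (b m) (n m) (s m)"
    "\<And>m k. k \<in> {1..n m} \<Longrightarrow> s m k - s m (k - 1) < 1 / Suc m"
    "(\<lambda>m. inner (F (b m) x) x - inner (F (a m) x) x) \<longlonglongrightarrow> (norm x)\<^sup>2"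
    "(\<lambda>m. inner (spectral_sum F x (n m) (s m)) x) \<longlonglongrightarrow> inner (T x) x"
    by (fact represents_sequence[OF x])
  have const: "F d x = x" if "c \<le> d" for d
    using spectral_family_absorb(2)[OF that, of x] Fx by simp
  have bound: "inner (spectral_sum F x (n m) (s m)) x \<le>
      (c + 1 / Suc m) * (inner (F (b m) x) x - inner (F (a m) x) x)" for m
    unfolding spectral_sum_inner[OF *(1)] block_norm_sum[OF *(1), symmetric] sum_distrib_left
  proof (rule sum_mono)
    fix k assume k: "k \<in> {1..n m}"
    have less: "s m (k - 1) < s m k"
      using k *(1)[of m] by (auto simp: is_partition_def)
    show "s m k * (norm (F (s m k) x - F (s m (k - 1)) x))\<^sup>2 \<le>
        (c + 1 / Suc m) * (norm (F (s m k) x - F (s m (k - 1)) x))\<^sup>2"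
    proof (cases "c \<le> s m (k - 1)")
      case True
      then show ?thesis using const less by simp
    next
      case False
      then have "s m k \<le> c + 1 / Suc m"
        using *(2)[OF k] by linarith
      then show ?thesis by (rule mult_right_mono) simp
    qed
  qed
  have lim: "(\<lambda>m. (c + 1 / Suc m) * (inner (F (b m) x) x - inner (F (a m) x) x))
      \<longlonglongrightarrow> (c + 0) * (norm x)\<^sup>2"
    by (intro tendsto_intros *(3) LIMSEQ_Suc[OF lim_1_over_n])
  have "inner (T x) x \<le> (c + 0) * (norm x)\<^sup>2"
    by (rule LIMSEQ_le[OF *(4) lim]) (use bound in blast)
  then show ?thesis by simp
qed

text \<open>Blocks ending at or below \<open>c\<close> vanish, and on the others the weight, being
  the right endpoint, already exceeds \<open>c\<close>; no mesh error arises.\<close>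

lemma represents_form_ge:
  assumes x: "x \<in> D" and Fx: "F c x = 0"
  shows "c * (norm x)\<^sup>2 \<le> inner (T x) x"
proof -
  obtain a b n s where *: "\<And>m. is_partition (a m) (b m) (n m) (s m)"
    "\<And>m k. k \<in> {1..n m} \<Longrightarrow> s m k - s m (k - 1) < 1 / Suc m"
    "(\<lambda>m. inner (F (b m) x) x - inner (F (a m) x) x) \<longlonglongrightarrow> (norm x)\<^sup>2"
    "(\<lambda>m. inner (spectral_sum F x (n m) (s m)) x) \<longlonglongrightarrow> inner (T x) x"
    by (fact represents_sequence[OF x])
  have zero: "F d x = 0" if "d \<le> c" for d
    using spectral_family_absorb(1)[OF that, of x] Fx ortho_projD(6)[OF spectral_family_ortho_proj]
    by simp
  have bound: "c * (inner (F (b m) x) x - inner (F (a m) x) x) \<le> inner (spectral_sum F x (n m) (s m)) x" for m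
    unfolding spectral_sum_inner[OF *(1)] block_norm_sum[OF *(1), symmetric] sum_distrib_left
  proof (rule sum_mono)
    fix k assume k: "k \<in> {1..n m}"
    have less: "s m (k - 1) < s m k"
      using k *(1)[of m] by (auto simp: is_partition_def)
    show "c * (norm (F (s m k) x - F (s m (k - 1)) x))\<^sup>2 \<le>
        s m k * (norm (F (s m k) x - F (s m (k - 1)) x))\<^sup>2"
      using zero less by (cases "s m k \<le> c") (auto intro: mult_right_mono)
  qed
  have lim: "(\<lambda>m. c * (inner (F (b m) x) x - inner (F (a m) x) x)) \<longlonglongrightarrow> c * (norm x)\<^sup>2"
    by (intro tendsto_intros *(3))
  show ?thesis
    by (rule LIMSEQ_le[OF lim *(4)]) (use bound in blast)
qed

lemma represents_below_E:
  assumes "c < d"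
  shows "F c (E d x) = F c x"
  by (rule proj_comparison[OF spectral_family_ortho_proj represents_commutes ortho_proj_E E_commutes
        _ represents_form_le E_form_ge assms])
    (simp add: commute_E_ortho_proj spectral_family_ortho_proj represents_commutes)

lemma E_below_represents:
  assumes "c < d"
  shows "E c (F d x) = E c x"
  by (rule proj_comparison[OF ortho_proj_E E_commutes spectral_family_ortho_proj represents_commutes
        _ E_form_le represents_form_ge assms])
    (simp add: commute_E_ortho_proj spectral_family_ortho_proj represents_commutes)

end

end

text \<open>For \<open>c < m < d\<close> the constructed projection \<open>E m\<close> sits between
  \<open>F c\<close> and \<open>G d\<close>, so \<open>F c\<close> absorbs \<open>G d\<close>.
  Right-continuity of \<open>G\<close> allows \<open>d\<close> to decrease to
  \<open>c\<close>.\<close>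

lemma represents_absorb:
  assumes sa: "self_adjoint_operator D T"
    and F: "spectral_family F" "represents_operator F D T"
    and G: "spectral_family G" "represents_operator G D T" "right_continuous_family G"
  shows "F c (G c x) = F c x"
proof -
  interpret real_self_adjoint D T
    using sa by (rule self_adjoint_operator_real)
  have eq: "F c (G d x) = F c x" if "c < d" for d
  proof -
    obtain m where "c < m" "m < d"
      using dense[OF \<open>c < d\<close>] by blast
    then show ?thesis
      using represents_below_E[OF F(1) sa F(2), of c m] E_below_represents[OF G(1) sa G(2), of m d]
      by metis
  qed
  have "((\<lambda>d. F c (G d x)) \<longlongrightarrow> F c (G c x)) (at_right c)"
    using G(3)
    by (intro bounded_linear.tendsto[OF ortho_proj_bounded_linear[OF spectral_family_ortho_proj[OF F(1)]]])
      (simp add: right_continuous_family_def)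
  moreover have "((\<lambda>d. F c (G d x)) \<longlongrightarrow> F c x) (at_right c)"
    by (rule tendsto_eventually) (use eq in \<open>auto simp: eventually_at_filter\<close>)
  ultimately show ?thesis
    by (rule tendsto_unique[rotated]) simp
qed

theorem theorem4p4:
  fixes D :: "'a::complex_hilbert_space set" and T :: "'a \<Rightarrow> 'a"
  assumes "self_adjoint_operator D T"
  shows "(\<exists>E. spectral_family E \<and> represents_operator E D T) \<and>
    (\<forall>E F. spectral_family E \<and> represents_operator E D T \<and> right_continuous_family E \<and>
           spectral_family F \<and> represents_operator F D T \<and> right_continuous_family F
           \<longrightarrow> E = F)"
proof (intro conjI allI impI)
  show "\<exists>E. spectral_family E \<and> represents_operator E D T"
    using spectral_family_E[OF assms] represents_operator_E[OF assms] by blast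
  fix E F
  assume "spectral_family E \<and> represents_operator E D T \<and> right_continuous_family E \<and>
    spectral_family F \<and> represents_operator F D T \<and> right_continuous_family F"
  then have E: "spectral_family E" "represents_operator E D T" "right_continuous_family E"
    and F: "spectral_family F" "represents_operator F D T" "right_continuous_family F"
    by auto
  have "E c x = F c x" for c x
  proof -
    \<comment> \<open>This inclusion of ranges uses the right-continuity of \<open>E\<close>, the
      reverse one that of \<open>F\<close>.\<close>
    have "E c (F c x) = F c x"
      by (rule ortho_proj_absorb_sym[OF spectral_family_ortho_proj[OF F(1)] spectral_family_ortho_proj[OF E(1)]])
        (rule represents_absorb[OF assms F(1,2) E])
    moreover have "E c (F c x) = E c x"
      by (rule represents_absorb[OF assms E(1,2) F])
    ultimately show ?thesis by simp
  qed
  then show "E = F" by (intro ext)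
qed

end
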